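(* Let $\mathscr T$ be a rigidly-compactly generated tensor triangulated category. If $\mathscr T$ is stratified, then the Balmer spectrum $\mathrm{Spc}(\mathscr T^c)$ is weakly Noetherian.
   Context: A rigidly-compactly generated tensor triangulated category $\mathscr T$ is a triangulated category with small coproducts and a compatible closed symmetric monoidal structure $(\otimes,\mathbb 1)$, compactly generated, whose compact objects coincide with its rigid (dualizable) objects (so $\mathbb 1$ is compact). $\mathscr T^c$ is the full subcategory of compact objects. $\mathrm{Spc}(\mathscr T^c)$ is the set of prime thick tensor ideals $\mathscr P$ of $\mathscr T^c$; for $a\in\mathscr T^c$ put $\mathrm{supp}(a)=\{\mathscr P: a\notin\mathscr P\}$, and these sets form a basis of closed subsets of the topology. It is a spectral space. Let $X$ be a spectral space. A subset of $X$ is Thomason if it is a union of closed subsets each of which has quasi-compact complement. A subset $W\subseteq X$ is weakly visible if $W=U\cap V^c$ for Thomason subsets $U,V$ (where $V^c$ is the complement). $X$ is weakly Noetherian if every singleton $\{x\}$, $x\in X$, is weakly visible. The weakly visible subsets form a basis of open sets of the localizing topology on $X$; a subset is localizing closed if it is closed in this topology. For a Thomason subset $Y\subseteq \mathrm{Spc}(\mathscr T^c)$ let $\mathscr T^c_Y=\{a\in\mathscr T^c:\mathrm{supp}(a)\subseteq Y\}$. There is an exact triangle $e_Y\to\mathbb 1\to f_Y\to\Sigma e_Y$, unique up to unique isomorphism, with $e_Y$ in the localizing subcategory $\mathrm{Loc}\langle\mathscr T^c_Y\rangle$ and $\mathrm{Hom}_{\mathscr T}(s,f_Y)=0$ for all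 $s\in\mathrm{Loc}\langle\mathscr T^c_Y\rangle$. For a weakly visible $W=U\cap V^c$ put $g_W=e_U\otimes f_V$ (independent of the choice of $U,V$ up to isomorphism). The tensor triangular support of $t\in\mathscr T$ is $$\mathrm{Supp}(t)=\{\mathscr P\in\mathrm{Spc}(\mathscr T^c): g_W\otimes t\neq 0\text{ for every weakly visible subset }W\text{ containing }\mathscr P\}.$$ For a class $\mathscr L$ of objects, $\mathrm{Supp}(\mathscr L)=\bigcup_{t\in\mathscr L}\mathrm{Supp}(t)$; if $\mathscr L$ is a localizing subcategory, $\mathrm{Supp}(\mathscr L)$ is localizing closed. A localizing ideal is a localizing subcategory $\mathscr L$ with $\mathscr L\otimes\mathscr T\subseteq\mathscr L$. $\mathscr T$ is stratified if the map $\mathscr L\mapsto\mathrm{Supp}(\mathscr L)$, from localizing ideals of $\mathscr T$ to localizing closed subsets of $\mathrm{Spc}(\mathscr T^c)$, is a bijection. *)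

theory Defs
  imports "HOL-Algebra.Free_Abelian_Groups" "HOL-Analysis.Abstract_Topology"
begin

unbundle cardinal_syntax

text \<open>
  Smallness is relative to a cardinal \<open>\<kappa>\<close>, the size of the universe: a set is small when it
  has fewer than \<open>\<kappa>\<close> elements. A class of objects (arrows) is an arbitrary type, and
  \<open>\<kappa>\<close> is required to be uncountable and regular. The usual setting is the case of an
  inaccessible \<open>\<kappa>\<close> (a Grothendieck universe).
\<close>

definition universe_card :: "'u rel \<Rightarrow> bool" where
  "universe_card \<kappa> \<longleftrightarrow> Card_order \<kappa> \<and> regularCard \<kappa> \<and> natLeq <o \<kappa>"

definition small :: "'u rel \<Rightarrow> 'a set \<Rightarrow> bool" where
  "small \<kappa> A \<longleftrightarrow> |A| <o \<kappa>"


section \<open>Additive categories\<close>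

text \<open>
  All elements of the types \<open>'o\<close> and \<open>'m\<close> are objects and arrows. Composition is a total
  function whose value matters only on composable arrows; likewise addition of arrows matters
  only for parallel ones.
\<close>

record ('o, 'm) acat =
  src    :: "'m \<Rightarrow> 'o"
  trg    :: "'m \<Rightarrow> 'o"
  idm    :: "'o \<Rightarrow> 'm" ("\<i>\<index>")
  cmp    :: "'m \<Rightarrow> 'm \<Rightarrow> 'm" (infixr "\<cdot>\<index>" 70)
  zmor   :: "'o \<Rightarrow> 'o \<Rightarrow> 'm"
  padd   :: "'m \<Rightarrow> 'm \<Rightarrow> 'm"

definition Hom :: "('o, 'm, 'z) acat_scheme \<Rightarrow> 'o \<Rightarrow> 'o \<Rightarrow> 'm set" where
  "Hom C x y = {f. src C f = x \<and> trg C f = y}"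

definition HomGrp :: "('o, 'm, 'z) acat_scheme \<Rightarrow> 'o \<Rightarrow> 'o \<Rightarrow> 'm monoid" where
  "HomGrp C x y = \<lparr>carrier = Hom C x y, mult = padd C, one = zmor C x y\<rparr>"

definition Iso :: "('o, 'm, 'z) acat_scheme \<Rightarrow> 'o \<Rightarrow> 'o \<Rightarrow> 'm set" where
  "Iso C x y = {f \<in> Hom C x y. \<exists>g \<in> Hom C y x. cmp C g f = idm C x \<and> cmp C f g = idm C y}"

definition isomorphic :: "('o, 'm, 'z) acat_scheme \<Rightarrow> 'o \<Rightarrow> 'o \<Rightarrow> bool" where
  "isomorphic C x y \<longleftrightarrow> Iso C x y \<noteq> {}"

definition zero_obj :: "('o, 'm, 'z) acat_scheme \<Rightarrow> 'o \<Rightarrow> bool" where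
  "zero_obj C z \<longleftrightarrow> (\<forall>x. (\<exists>!f. f \<in> Hom C x z) \<and> (\<exists>!f. f \<in> Hom C z x))"

definition biproduct ::
  "('o, 'm, 'z) acat_scheme \<Rightarrow> 'o \<Rightarrow> 'o \<Rightarrow> 'o \<Rightarrow> 'm \<Rightarrow> 'm \<Rightarrow> 'm \<Rightarrow> 'm \<Rightarrow> bool" where
  "biproduct C x y s i j p q \<longleftrightarrow>
     i \<in> Hom C x s \<and> j \<in> Hom C y s \<and> p \<in> Hom C s x \<and> q \<in> Hom C s y \<and>
     cmp C p i = idm C x \<and> cmp C q j = idm C y \<and>
     cmp C p j = zmor C y x \<and> cmp C q i = zmor C x y \<and>
     padd C (cmp C i p) (cmp C j q) = idm C s"

definition direct_summand :: "('o, 'm, 'z) acat_scheme \<Rightarrow> 'o \<Rightarrow> 'o \<Rightarrow> bool" where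
  "direct_summand C x s \<longleftrightarrow> (\<exists>y i j p q. biproduct C x y s i j p q)"

definition coproduct ::
  "('o, 'm, 'z) acat_scheme \<Rightarrow> 'u set \<Rightarrow> ('u \<Rightarrow> 'o) \<Rightarrow> 'o \<Rightarrow> ('u \<Rightarrow> 'm) \<Rightarrow> bool" where
  "coproduct C I x c j \<longleftrightarrow>
     (\<forall>i\<in>I. j i \<in> Hom C (x i) c) \<and>
     (\<forall>z f. (\<forall>i\<in>I. f i \<in> Hom C (x i) z) \<longrightarrow>
        (\<exists>!h. h \<in> Hom C c z \<and> (\<forall>i\<in>I. cmp C h (j i) = f i)))"

locale additive_category =
  fixes C :: "('o, 'm, 'z) acat_scheme" (structure)
  assumes id_Hom: "\<i> x \<in> Hom C x x"
    and comp_Hom: "\<lbrakk>f \<in> Hom C x y; g \<in> Hom C y z\<rbrakk> \<Longrightarrow> g \<cdot> f \<in> Hom C x z"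
    and comp_id: "f \<in> Hom C x y \<Longrightarrow> f \<cdot> \<i> x = f"
    and id_comp: "f \<in> Hom C x y \<Longrightarrow> \<i> y \<cdot> f = f"
    and comp_assoc: "\<lbrakk>f \<in> Hom C w x; g \<in> Hom C x y; h \<in> Hom C y z\<rbrakk>
          \<Longrightarrow> (h \<cdot> g) \<cdot> f = h \<cdot> (g \<cdot> f)"
    and Hom_comm_group: "comm_group (HomGrp C x y)"
    and comp_add_left: "\<lbrakk>f \<in> Hom C x y; g \<in> Hom C y z; h \<in> Hom C y z\<rbrakk>
          \<Longrightarrow> padd C g h \<cdot> f = padd C (g \<cdot> f) (h \<cdot> f)"
    and comp_add_right: "\<lbrakk>f \<in> Hom C x y; g \<in> Hom C x y; h \<in> Hom C y z\<rbrakk>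
          \<Longrightarrow> h \<cdot> padd C f g = padd C (h \<cdot> f) (h \<cdot> g)"
    and zero_exists: "\<exists>z. zero_obj C z"
    and biproduct_exists: "\<exists>s i j p q. biproduct C x y s i j p q"


section \<open>Triangulated categories\<close>

text \<open>\<open>(f, g, h) \<in> tri C\<close> means that \<open>x \<rightarrow> y \<rightarrow> z \<rightarrow> \<Sigma>x\<close>, with arrows \<open>f\<close>, \<open>g\<close>, \<open>h\<close>,
  is an exact triangle. The suspension is an auto-equivalence.\<close>

record ('o, 'm) tcat = "('o, 'm) acat" +
  sus   :: "'o \<Rightarrow> 'o" ("\<S>\<index>")
  susm  :: "'m \<Rightarrow> 'm" ("\<s>\<index>")
  tri   :: "('m \<times> 'm \<times> 'm) set"

definition neg :: "('o, 'm, 'z) acat_scheme \<Rightarrow> 'm \<Rightarrow> 'm" where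
  "neg C f = m_inv (HomGrp C (src C f) (trg C f)) f"

locale triangulated_category = additive_category C
  for C :: "('o, 'm, 'z) tcat_scheme" (structure) +
  assumes sus_Hom: "f \<in> Hom C x y \<Longrightarrow> \<s> f \<in> Hom C (\<S> x) (\<S> y)"
    and sus_id: "\<s> (\<i> x) = \<i> (\<S> x)"
    and sus_comp: "\<lbrakk>f \<in> Hom C x y; g \<in> Hom C y z\<rbrakk> \<Longrightarrow> \<s> (g \<cdot> f) = \<s> g \<cdot> \<s> f"
    and sus_add: "\<lbrakk>f \<in> Hom C x y; g \<in> Hom C x y\<rbrakk> \<Longrightarrow> \<s> (padd C f g) = padd C (\<s> f) (\<s> g)"
    and sus_fully_faithful: "bij_betw \<s> (Hom C x y) (Hom C (\<S> x) (\<S> y))"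
    and sus_ess_surj: "\<exists>x. isomorphic C (\<S> x) y"
    and tri_Hom: "(f, g, h) \<in> tri C
          \<Longrightarrow> \<exists>x y z. f \<in> Hom C x y \<and> g \<in> Hom C y z \<and> h \<in> Hom C z (\<S> x)"
    and tri_id: "zero_obj C z \<Longrightarrow> (\<i> x, zmor C x z, zmor C z (\<S> x)) \<in> tri C"
    and tri_iso: "\<lbrakk>(f, g, h) \<in> tri C;
          f \<in> Hom C x y; g \<in> Hom C y z; h \<in> Hom C z (\<S> x);
          f' \<in> Hom C x' y'; g' \<in> Hom C y' z'; h' \<in> Hom C z' (\<S> x');
          u \<in> Iso C x x'; v \<in> Iso C y y'; w \<in> Iso C z z';
          f' \<cdot> u = v \<cdot> f; g' \<cdot> v = w \<cdot> g; h' \<cdot> w = \<s> u \<cdot> h\<rbrakk> \<Longrightarrow> (f', g', h') \<in> tri C"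
    and tri_cone: "f \<in> Hom C x y \<Longrightarrow> \<exists>g h. (f, g, h) \<in> tri C"
    and tri_rotate: "\<lbrakk>f \<in> Hom C x y; g \<in> Hom C y z; h \<in> Hom C z (\<S> x)\<rbrakk>
          \<Longrightarrow> (f, g, h) \<in> tri C \<longleftrightarrow> (g, h, neg C (\<s> f)) \<in> tri C"
    and tri_morphism: "\<lbrakk>(f, g, h) \<in> tri C; (f', g', h') \<in> tri C;
          f \<in> Hom C x y; g \<in> Hom C y z; h \<in> Hom C z (\<S> x);
          f' \<in> Hom C x' y'; g' \<in> Hom C y' z'; h' \<in> Hom C z' (\<S> x');
          u \<in> Hom C x x'; v \<in> Hom C y y'; f' \<cdot> u = v \<cdot> f\<rbrakk>
          \<Longrightarrow> \<exists>w \<in> Hom C z z'. g' \<cdot> v = w \<cdot> g \<and> h' \<cdot> w = \<s> u \<cdot> h"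
    and octahedral: "\<lbrakk>f \<in> Hom C x y; g \<in> Hom C y z;
          (f, f1, f2) \<in> tri C; f1 \<in> Hom C y a; f2 \<in> Hom C a (\<S> x);
          (g, g1, g2) \<in> tri C; g1 \<in> Hom C z b; g2 \<in> Hom C b (\<S> y);
          (g \<cdot> f, k1, k2) \<in> tri C; k1 \<in> Hom C z c; k2 \<in> Hom C c (\<S> x)\<rbrakk>
          \<Longrightarrow> \<exists>u \<in> Hom C a c. \<exists>v \<in> Hom C c b. (u, v, \<s> f1 \<cdot> g2) \<in> tri C \<and>
                u \<cdot> f1 = k1 \<cdot> g \<and> k2 \<cdot> u = f2 \<and> v \<cdot> k1 = g1 \<and> g2 \<cdot> v = \<s> f \<cdot> k2"

text \<open>Full subcategories are identified with their sets of objects; triangulated subcategories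
  are closed under isomorphism.\<close>

definition triangulated_subcategory :: "('o, 'm, 'z) tcat_scheme \<Rightarrow> 'o set \<Rightarrow> bool" where
  "triangulated_subcategory C L \<longleftrightarrow>
     L \<noteq> {} \<and>
     (\<forall>x y. x \<in> L \<and> isomorphic C x y \<longrightarrow> y \<in> L) \<and>
     (\<forall>x. x \<in> L \<longleftrightarrow> sus C x \<in> L) \<and>
     (\<forall>f g h x y z. (f, g, h) \<in> tri C \<and> f \<in> Hom C x y \<and> g \<in> Hom C y z \<and> x \<in> L \<and> y \<in> L
        \<longrightarrow> z \<in> L)"

definition thick_subcategory :: "('o, 'm, 'z) tcat_scheme \<Rightarrow> 'o set \<Rightarrow> bool" where
  "thick_subcategory C L \<longleftrightarrow>
     triangulated_subcategory C L \<and> (\<forall>x s. s \<in> L \<and> direct_summand C x s \<longrightarrow> x \<in> L)"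

definition localizing_subcategory ::
  "'u rel \<Rightarrow> ('o, 'm, 'z) tcat_scheme \<Rightarrow> 'o set \<Rightarrow> bool" where
  "localizing_subcategory \<kappa> C L \<longleftrightarrow>
     triangulated_subcategory C L \<and>
     (\<forall>(I :: 'u set) x c j. small \<kappa> I \<and> (\<forall>i\<in>I. x i \<in> L) \<and> coproduct C I x c j \<longrightarrow> c \<in> L)"

definition Loc :: "'u rel \<Rightarrow> ('o, 'm, 'z) tcat_scheme \<Rightarrow> 'o set \<Rightarrow> 'o set" where
  "Loc \<kappa> C S = \<Inter>{L. localizing_subcategory \<kappa> C L \<and> S \<subseteq> L}"

text \<open>\<open>x\<close> is compact when, for every small family, the canonical homomorphism
  \<open>\<Oplus>\<^sub>i Hom(x, y\<^sub>i) \<rightarrow> Hom(x, \<Coprod>\<^sub>i y\<^sub>i)\<close> is an isomorphism; the groups are written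
  multiplicatively, as \<^const>\<open>sum_group\<close> requires.\<close>

definition compact_obj :: "'u rel \<Rightarrow> ('o, 'm, 'z) acat_scheme \<Rightarrow> 'o \<Rightarrow> bool" where
  "compact_obj \<kappa> C x \<longleftrightarrow>
     (\<forall>(I :: 'u set) y c j. small \<kappa> I \<and> coproduct C I y c j \<longrightarrow>
        (\<lambda>\<phi>. gfinprod (HomGrp C x c) (\<lambda>i. cmp C (j i) (\<phi> i)) I)
          \<in> iso (sum_group I (\<lambda>i. HomGrp C x (y i))) (HomGrp C x c))"

definition compacts :: "'u rel \<Rightarrow> ('o, 'm, 'z) acat_scheme \<Rightarrow> 'o set" where
  "compacts \<kappa> C = {x. compact_obj \<kappa> C x}"

definition compactly_generated :: "'u rel \<Rightarrow> ('o, 'm, 'z) acat_scheme \<Rightarrow> bool" where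
  "compactly_generated \<kappa> C \<longleftrightarrow>
     (\<exists>G \<subseteq> compacts \<kappa> C. small \<kappa> G \<and>
        (\<forall>t. (\<forall>g\<in>G. Hom C g t = {zmor C g t}) \<longrightarrow> zero_obj C t))"


section \<open>Tensor triangulated categories\<close>

text \<open>\<open>sten C x y\<close> is the natural isomorphism \<open>\<Sigma>x \<otimes> y \<cong> \<Sigma>(x \<otimes> y)\<close> making
  \<open>- \<otimes> y\<close> an exact functor.\<close>

record ('o, 'm) ttcat = "('o, 'm) tcat" +
  ten   :: "'o \<Rightarrow> 'o \<Rightarrow> 'o" (infixr "\<odot>\<index>" 75)
  tenm  :: "'m \<Rightarrow> 'm \<Rightarrow> 'm" (infixr "\<star>\<index>" 75)
  unt   :: 'o ("\<I>\<index>")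
  asc   :: "'o \<Rightarrow> 'o \<Rightarrow> 'o \<Rightarrow> 'm"
  lun   :: "'o \<Rightarrow> 'm"
  run   :: "'o \<Rightarrow> 'm"
  brd   :: "'o \<Rightarrow> 'o \<Rightarrow> 'm"
  sten  :: "'o \<Rightarrow> 'o \<Rightarrow> 'm"

locale tensor_triangulated_category = triangulated_category C
  for C :: "('o, 'm, 'z) ttcat_scheme" (structure) +
  assumes ten_Hom: "\<lbrakk>f \<in> Hom C x y; g \<in> Hom C x' y'\<rbrakk> \<Longrightarrow> f \<star> g \<in> Hom C (x \<odot> x') (y \<odot> y')"
    and ten_id: "\<i> x \<star> \<i> y = \<i> (x \<odot> y)"
    and ten_comp: "\<lbrakk>f \<in> Hom C x y; g \<in> Hom C y z; f' \<in> Hom C x' y'; g' \<in> Hom C y' z'\<rbrakk>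
          \<Longrightarrow> (g \<cdot> f) \<star> (g' \<cdot> f') = (g \<star> g') \<cdot> (f \<star> f')"
    and asc_Iso: "asc C x y z \<in> Iso C ((x \<odot> y) \<odot> z) (x \<odot> (y \<odot> z))"
    and asc_natural: "\<lbrakk>f \<in> Hom C x x'; g \<in> Hom C y y'; h \<in> Hom C z z'\<rbrakk>
          \<Longrightarrow> asc C x' y' z' \<cdot> ((f \<star> g) \<star> h) = (f \<star> (g \<star> h)) \<cdot> asc C x y z"
    and lun_Iso: "lun C x \<in> Iso C (\<I> \<odot> x) x"
    and lun_natural: "f \<in> Hom C x y \<Longrightarrow> lun C y \<cdot> (\<i> \<I> \<star> f) = f \<cdot> lun C x"
    and run_Iso: "run C x \<in> Iso C (x \<odot> \<I>) x"
    and run_natural: "f \<in> Hom C x y \<Longrightarrow> run C y \<cdot> (f \<star> \<i> \<I>) = f \<cdot> run C x"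
    and pentagon: "asc C w x (y \<odot> z) \<cdot> asc C (w \<odot> x) y z
          = (\<i> w \<star> asc C x y z) \<cdot> asc C w (x \<odot> y) z \<cdot> (asc C w x y \<star> \<i> z)"
    and triangle: "(\<i> x \<star> lun C y) \<cdot> asc C x \<I> y = run C x \<star> \<i> y"
    and brd_Iso: "brd C x y \<in> Iso C (x \<odot> y) (y \<odot> x)"
    and brd_natural: "\<lbrakk>f \<in> Hom C x x'; g \<in> Hom C y y'\<rbrakk>
          \<Longrightarrow> brd C x' y' \<cdot> (f \<star> g) = (g \<star> f) \<cdot> brd C x y"
    and brd_symmetric: "brd C y x \<cdot> brd C x y = \<i> (x \<odot> y)"
    and hexagon: "asc C y z x \<cdot> brd C x (y \<odot> z) \<cdot> asc C x y z
          = (\<i> y \<star> brd C x z) \<cdot> asc C y x z \<cdot> (brd C x y \<star> \<i> z)"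
    and closed: "\<exists>h. \<exists>ev \<in> Hom C (h \<odot> y) z. \<forall>x. \<forall>f \<in> Hom C (x \<odot> y) z.
          \<exists>!g. g \<in> Hom C x h \<and> ev \<cdot> (g \<star> \<i> y) = f"
    \<comment> \<open>Compatibility: the tensor product is exact in each variable. Only the left variable
        is stated; the right one is obtained by conjugating with the braiding. Neither coherence
        of \<open>sten\<close> with \<open>asc\<close> and \<open>run\<close>, nor the sign rule for the braiding of suspensions,
        nor exactness of the internal hom is demanded.\<close>
    and ten_add: "\<lbrakk>f \<in> Hom C x y; g \<in> Hom C x y\<rbrakk>
          \<Longrightarrow> padd C f g \<star> \<i> w = padd C (f \<star> \<i> w) (g \<star> \<i> w)"
    and sten_Iso: "sten C x y \<in> Iso C (\<S> x \<odot> y) (\<S> (x \<odot> y))"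
    and sten_natural: "\<lbrakk>f \<in> Hom C x x'; g \<in> Hom C y y'\<rbrakk>
          \<Longrightarrow> sten C x' y' \<cdot> (\<s> f \<star> g) = \<s> (f \<star> g) \<cdot> sten C x y"
    and ten_exact: "\<lbrakk>(f, g, h) \<in> tri C; f \<in> Hom C x y; g \<in> Hom C y z; h \<in> Hom C z (\<S> x)\<rbrakk>
          \<Longrightarrow> (f \<star> \<i> w, g \<star> \<i> w, sten C x w \<cdot> (h \<star> \<i> w)) \<in> tri C"

definition inv_arr :: "('o, 'm, 'z) acat_scheme \<Rightarrow> 'm \<Rightarrow> 'm" where
  "inv_arr C f = (THE g. g \<in> Hom C (trg C f) (src C f) \<and>
     cmp C g f = idm C (src C f) \<and> cmp C f g = idm C (trg C f))"

text \<open>Rigidity: there is a dual \<open>d\<close> with evaluation and coevaluation satisfying the two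
  triangle identities.\<close>

definition rigid_obj :: "('o, 'm, 'z) ttcat_scheme \<Rightarrow> 'o \<Rightarrow> bool" where
  "rigid_obj C x \<longleftrightarrow>
     (\<exists>d. \<exists>ev \<in> Hom C (ten C d x) (unt C). \<exists>coev \<in> Hom C (unt C) (ten C x d).
        cmp C (run C x) (cmp C (tenm C (idm C x) ev)
          (cmp C (asc C x d x) (tenm C coev (idm C x)))) = lun C x \<and>
        cmp C (lun C d) (cmp C (tenm C ev (idm C d))
          (cmp C (inv_arr C (asc C d x d)) (tenm C (idm C d) coev))) = run C d)"

locale rigidly_compactly_generated = tensor_triangulated_category C
  for \<kappa> :: "'u rel" and C :: "('o, 'm, 'z) ttcat_scheme" (structure) +
  assumes universe: "universe_card \<kappa>"
    and locally_small: "small \<kappa> (Hom C x y)"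
    and small_coproducts: "small \<kappa> (I :: 'u set) \<Longrightarrow> \<exists>c j. coproduct C I X c j"
    and compactly_generated: "compactly_generated \<kappa> C"
    and compact_iff_rigid: "compact_obj \<kappa> C x \<longleftrightarrow> rigid_obj C x"


section \<open>Thomason subsets and the localizing topology\<close>

definition thomason :: "'a topology \<Rightarrow> 'a set \<Rightarrow> bool" where
  "thomason X Y \<longleftrightarrow>
     (\<exists>\<Z>. Y = \<Union>\<Z> \<and> (\<forall>Z\<in>\<Z>. closedin X Z \<and> compactin X (topspace X - Z)))"

definition weakly_visible :: "'a topology \<Rightarrow> 'a set \<Rightarrow> bool" where
  "weakly_visible X W \<longleftrightarrow>
     (\<exists>U V. thomason X U \<and> thomason X V \<and> W = U \<inter> (topspace X - V))"

definition weakly_noetherian :: "'a topology \<Rightarrow> bool" where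
  "weakly_noetherian X \<longleftrightarrow> (\<forall>x \<in> topspace X. weakly_visible X {x})"

definition localizing_topology :: "'a topology \<Rightarrow> 'a topology" where
  "localizing_topology X = topology (arbitrary union_of weakly_visible X)"


section \<open>The Balmer spectrum\<close>

definition thick_tensor_ideal :: "'u rel \<Rightarrow> ('o, 'm, 'z) ttcat_scheme \<Rightarrow> 'o set \<Rightarrow> bool" where
  "thick_tensor_ideal \<kappa> C P \<longleftrightarrow>
     P \<subseteq> compacts \<kappa> C \<and> thick_subcategory C P \<and>
     (\<forall>a \<in> compacts \<kappa> C. \<forall>b \<in> P. ten C a b \<in> P)"

definition prime_ideal :: "'u rel \<Rightarrow> ('o, 'm, 'z) ttcat_scheme \<Rightarrow> 'o set \<Rightarrow> bool" where
  "prime_ideal \<kappa> C P \<longleftrightarrow>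
     thick_tensor_ideal \<kappa> C P \<and> P \<noteq> compacts \<kappa> C \<and>
     (\<forall>a \<in> compacts \<kappa> C. \<forall>b \<in> compacts \<kappa> C. ten C a b \<in> P \<longrightarrow> a \<in> P \<or> b \<in> P)"

definition supp :: "'u rel \<Rightarrow> ('o, 'm, 'z) ttcat_scheme \<Rightarrow> 'o \<Rightarrow> 'o set set" where
  "supp \<kappa> C a = {P. prime_ideal \<kappa> C P \<and> a \<notin> P}"

text \<open>A basis of open sets is given by the complements of the sets \<open>supp a\<close>, \<open>a\<close> compact;
  their union is the set of all primes, the empty intersection arising from \<open>a = 0\<close>.\<close>

definition Spc :: "'u rel \<Rightarrow> ('o, 'm, 'z) ttcat_scheme \<Rightarrow> 'o set topology" where
  "Spc \<kappa> C = topology (arbitrary union_of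
     (\<lambda>S. \<exists>a \<in> compacts \<kappa> C. S = {P. prime_ideal \<kappa> C P} - supp \<kappa> C a))"


section \<open>Tensor triangular support and stratification\<close>

definition compacts_on ::
  "'u rel \<Rightarrow> ('o, 'm, 'z) ttcat_scheme \<Rightarrow> 'o set set \<Rightarrow> 'o set" where
  "compacts_on \<kappa> C Y = {a \<in> compacts \<kappa> C. supp \<kappa> C a \<subseteq> Y}"

definition idempotent_triangle ::
  "'u rel \<Rightarrow> ('o, 'm, 'z) ttcat_scheme \<Rightarrow> 'o set set \<Rightarrow> 'o \<Rightarrow> 'o \<Rightarrow> bool" where
  "idempotent_triangle \<kappa> C Y e f \<longleftrightarrow>
     (\<exists>\<alpha> \<in> Hom C e (unt C). \<exists>\<beta> \<in> Hom C (unt C) f. \<exists>\<gamma> \<in> Hom C f (sus C e).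
        (\<alpha>, \<beta>, \<gamma>) \<in> tri C) \<and>
     e \<in> Loc \<kappa> C (compacts_on \<kappa> C Y) \<and>
     (\<forall>s \<in> Loc \<kappa> C (compacts_on \<kappa> C Y). Hom C s f = {zmor C s f})"

text \<open>The objects \<open>e\<^sub>Y\<close>, \<open>f\<^sub>Y\<close> and \<open>g\<^sub>W\<close> are defined up to isomorphism; a representative
  is chosen.\<close>

definition e_obj :: "'u rel \<Rightarrow> ('o, 'm, 'z) ttcat_scheme \<Rightarrow> 'o set set \<Rightarrow> 'o" where
  "e_obj \<kappa> C Y = (SOME e. \<exists>f. idempotent_triangle \<kappa> C Y e f)"

definition f_obj :: "'u rel \<Rightarrow> ('o, 'm, 'z) ttcat_scheme \<Rightarrow> 'o set set \<Rightarrow> 'o" where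
  "f_obj \<kappa> C Y = (SOME f. \<exists>e. idempotent_triangle \<kappa> C Y e f)"

definition g_obj :: "'u rel \<Rightarrow> ('o, 'm, 'z) ttcat_scheme \<Rightarrow> 'o set set \<Rightarrow> 'o" where
  "g_obj \<kappa> C W = (SOME g. \<exists>U V. thomason (Spc \<kappa> C) U \<and> thomason (Spc \<kappa> C) V \<and>
     W = U \<inter> (topspace (Spc \<kappa> C) - V) \<and> g = ten C (e_obj \<kappa> C U) (f_obj \<kappa> C V))"

definition Supp :: "'u rel \<Rightarrow> ('o, 'm, 'z) ttcat_scheme \<Rightarrow> 'o \<Rightarrow> 'o set set" where
  "Supp \<kappa> C t = {P \<in> topspace (Spc \<kappa> C).
     \<forall>W. weakly_visible (Spc \<kappa> C) W \<and> P \<in> W \<longrightarrow> \<not> zero_obj C (ten C (g_obj \<kappa> C W) t)}"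

definition SuppC :: "'u rel \<Rightarrow> ('o, 'm, 'z) ttcat_scheme \<Rightarrow> 'o set \<Rightarrow> 'o set set" where
  "SuppC \<kappa> C L = (\<Union>t\<in>L. Supp \<kappa> C t)"

definition localizing_ideal :: "'u rel \<Rightarrow> ('o, 'm, 'z) ttcat_scheme \<Rightarrow> 'o set \<Rightarrow> bool" where
  "localizing_ideal \<kappa> C L \<longleftrightarrow>
     localizing_subcategory \<kappa> C L \<and> (\<forall>s \<in> L. \<forall>t. ten C s t \<in> L)"

definition stratified :: "'u rel \<Rightarrow> ('o, 'm, 'z) ttcat_scheme \<Rightarrow> bool" where
  "stratified \<kappa> C \<longleftrightarrow>
     bij_betw (SuppC \<kappa> C) {L. localizing_ideal \<kappa> C L}
       {S. closedin (localizing_topology (Spc \<kappa> C)) S}"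

end

theory Submission
  imports Defs
begin

text \<open>
  For any class of objects, the objects whose tensor product with all of its members vanishes form
  a localizing ideal. Applied to the class of all \<open>c\<close> with \<open>x \<otimes> c = 0\<close>, injectivity of
  \<open>Supp\<close> on localizing ideals shows that an object \<open>x\<close> with empty support is zero. Since
  points are closed in the localizing topology, stratification provides for each prime \<open>P\<close> an
  object \<open>t\<^sub>P\<close> with support exactly \<open>{P}\<close>. The annihilator of \<open>t\<^sub>P\<close> contains
  \<open>t\<^sub>Q\<close> for all \<open>Q \<noteq> P\<close>, because \<open>t\<^sub>P \<otimes> t\<^sub>Q\<close> has empty support, but it is not
  everything, because \<open>t\<^sub>P \<noteq> 0\<close>. So its support, a closed set, is the complement of
  \<open>P\<close>; hence \<open>{P}\<close> is open, and an open point is weakly visible.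

  That points are closed rests on the quasi-compactness of the sets \<open>{P. a \<in> P}\<close>, obtained from
  Zorn's lemma: a thick tensor ideal maximal among those disjoint from a set closed under tensor
  products is prime.
\<close>

text \<open>Most of the work lies underneath the argument just described. Prime avoidance takes
  place inside the compact objects, so these must be shown to form a thick subcategory closed under
  \<open>\<odot>\<close>. Passing compactness to suspensions and cones is awkward when it is stated
  as an isomorphism out of a direct sum of Hom groups. A killing endomorphism turns it into an
  equation between arrows, which additive functors such as \<open>\<S>\<close> and tensoring with a
  fixed object transport. Closure under \<open>\<odot>\<close> is where compact = rigid enters:
  tensoring with a rigid object has tensoring with its dual as right adjoint, and that adjoint
  preserves coproducts because the monoidal structure is closed. On the side of supports, the
  objects \<open>g_obj \<kappa> C W\<close> serve as test objects: a statement about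
  \<open>Supp\<close> is a statement about which products with them vanish. Thus the formal
  inclusion of Supp(s \<otimes> t) in the intersection of the supports is enough, and an object with
  empty support is handled by comparing two annihilators instead of computing with
  idempotents.\<close>

no_notation imaginary_unit ("\<i>")

section \<open>Additive categories\<close>

context additive_category
begin

text \<open>Composition is total, so each categorical law has typing side conditions. Reducing
  membership in \<open>Hom\<close> to equations on \<open>src\<close> and \<open>trg\<close> lets
  the simplifier discharge them.\<close>

lemma in_Hom [simp]: "f \<in> Hom C x y \<longleftrightarrow> src C f = x \<and> trg C f = y"
  by (simp add: Hom_def)

lemma src_idm [simp]: "src C (\<i> x) = x" and trg_idm [simp]: "trg C (\<i> x) = x"
  using id_Hom[of x] by simp_all

lemma src_comp [simp]: "trg C f = src C g \<Longrightarrow> src C (g \<cdot> f) = src C f"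
  and trg_comp [simp]: "trg C f = src C g \<Longrightarrow> trg C (g \<cdot> f) = trg C g"
  using comp_Hom[of f "src C f" "trg C f" g "trg C g"] by simp_all

lemma comp_idm [simp]: "src C f = x \<Longrightarrow> f \<cdot> \<i> x = f"
  and idm_comp [simp]: "trg C f = x \<Longrightarrow> \<i> x \<cdot> f = f"
  using comp_id[of f x "trg C f"] id_comp[of f "src C f" x] by simp_all

lemma assoc [simp]:
  "\<lbrakk>trg C f = src C g; trg C g = src C h\<rbrakk> \<Longrightarrow> (h \<cdot> g) \<cdot> f = h \<cdot> (g \<cdot> f)"
  using comp_assoc[of f "src C f" "trg C f" g "trg C g" h "trg C h"] by simp

text \<open>\<open>assoc\<close> nests composites to the right, which hides a product
  \<open>f \<cdot> g\<close> sitting in front of a tail \<open>h\<close>. This form lets an equation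
  such as \<open>f \<cdot> g = \<i> x\<close> still be applied there.\<close>

lemma comp_cancel:
  "\<lbrakk>f \<cdot> g = k; trg C g = src C f; trg C h = src C g\<rbrakk> \<Longrightarrow> f \<cdot> (g \<cdot> h) = k \<cdot> h"
  using assoc[of h g f] by simp

lemma carrier_HomGrp [simp]: "carrier (HomGrp C x y) = Hom C x y"
  and mult_HomGrp [simp]: "mult (HomGrp C x y) = padd C"
  and one_HomGrp [simp]: "one (HomGrp C x y) = zmor C x y"
  by (simp_all add: HomGrp_def)

section \<open>The group structure on Hom sets\<close>

lemma group_HomGrp: "group (HomGrp C x y)"
  using Hom_comm_group comm_group_def by blast

lemma src_zmor [simp]: "src C (zmor C x y) = x" and trg_zmor [simp]: "trg C (zmor C x y) = y"
proof -
  interpret group "HomGrp C x y" by (rule group_HomGrp)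
  show "src C (zmor C x y) = x" "trg C (zmor C x y) = y"
    using one_closed by simp_all
qed

lemma src_padd [simp]: "\<lbrakk>src C f = src C g; trg C f = trg C g\<rbrakk> \<Longrightarrow> src C (padd C f g) = src C g"
  and trg_padd [simp]: "\<lbrakk>src C f = src C g; trg C f = trg C g\<rbrakk> \<Longrightarrow> trg C (padd C f g) = trg C g"
proof -
  interpret group "HomGrp C (src C g) (trg C g)" by (rule group_HomGrp)
  show "src C (padd C f g) = src C g" "trg C (padd C f g) = trg C g"
    if "src C f = src C g" "trg C f = trg C g"
    using m_closed[of f g] that by simp_all
qed

lemma padd_zmor [simp]: "\<lbrakk>src C f = x; trg C f = y\<rbrakk> \<Longrightarrow> padd C f (zmor C x y) = f"
  and zmor_padd [simp]: "\<lbrakk>src C f = x; trg C f = y\<rbrakk> \<Longrightarrow> padd C (zmor C x y) f = f"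
proof -
  interpret group "HomGrp C x y" by (rule group_HomGrp)
  show "padd C f (zmor C x y) = f" "padd C (zmor C x y) f = f"
    if "src C f = x" "trg C f = y"
    using r_one[of f] l_one[of f] that by simp_all
qed

text \<open>The only idempotent of a group is its unit. Hence every additive operation on arrows
  preserves zero; this is applied to composition, suspension and tensoring.\<close>

lemma padd_idem_imp_zmor:
  "\<lbrakk>padd C f f = f; src C f = x; trg C f = y\<rbrakk> \<Longrightarrow> f = zmor C x y"
proof -
  interpret group "HomGrp C x y" by (rule group_HomGrp)
  show "f = zmor C x y" if "padd C f f = f" "src C f = x" "trg C f = y"
    using r_cancel_one[of f f] that by simp
qed

lemma comp_padd [simp]:
  "\<lbrakk>src C f = src C g; trg C f = trg C g; trg C g = src C h\<rbrakk>
    \<Longrightarrow> h \<cdot> padd C f g = padd C (h \<cdot> f) (h \<cdot> g)"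
  using comp_add_right[of f "src C g" "src C h" g h "trg C h"] by simp

lemma padd_comp [simp]:
  "\<lbrakk>src C g = src C h; trg C g = trg C h; trg C f = src C h\<rbrakk>
    \<Longrightarrow> padd C g h \<cdot> f = padd C (g \<cdot> f) (h \<cdot> f)"
  using comp_add_left[of f "src C f" "src C h" g "trg C h" h] by simp

lemma comp_zmor [simp]: "src C f = y \<Longrightarrow> f \<cdot> zmor C x y = zmor C x (trg C f)"
  using comp_padd[of "zmor C x y" "zmor C x y" f] by (intro padd_idem_imp_zmor) simp_all

lemma zmor_comp [simp]: "trg C f = x \<Longrightarrow> zmor C x y \<cdot> f = zmor C (src C f) y"
  using padd_comp[of "zmor C x y" "zmor C x y" f] by (intro padd_idem_imp_zmor) simp_all

lemma src_neg [simp]: "src C (neg C f) = src C f" and trg_neg [simp]: "trg C (neg C f) = trg C f"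
proof -
  interpret group "HomGrp C (src C f) (trg C f)" by (rule group_HomGrp)
  show "src C (neg C f) = src C f" "trg C (neg C f) = trg C f"
    using inv_closed[of f] by (simp_all add: neg_def)
qed

lemma padd_neg [simp]: "padd C f (neg C f) = zmor C (src C f) (trg C f)"
proof -
  interpret group "HomGrp C (src C f) (trg C f)" by (rule group_HomGrp)
  show ?thesis using r_inv[of f] by (simp add: neg_def)
qed

lemma neg_zmor [simp]: "neg C (zmor C x y) = zmor C x y"
  using padd_neg[of "zmor C x y"] zmor_padd[of "neg C (zmor C x y)" x y] by simp

text \<open>Rotating a triangle introduces a sign; this removes it from a vanishing
  composite.\<close>

lemma neg_comp_eq_zmor:
  assumes "neg C f \<cdot> g = zmor C (src C g) (trg C f)" "trg C g = src C f"
  shows "f \<cdot> g = zmor C (src C g) (trg C f)"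
proof -
  have "padd C f (neg C f) \<cdot> g = padd C (f \<cdot> g) (neg C f \<cdot> g)"
    by (rule padd_comp) (use assms in auto)
  then show ?thesis using assms by simp
qed

section \<open>Isomorphisms\<close>

lemma IsoE:
  assumes "f \<in> Iso C x y"
  obtains g where "src C f = x" "trg C f = y" "src C g = y" "trg C g = x"
    "g \<cdot> f = \<i> x" "f \<cdot> g = \<i> y" "g \<in> Iso C y x"
proof -
  obtain g where "g \<in> Hom C y x" "g \<cdot> f = \<i> x" "f \<cdot> g = \<i> y" "f \<in> Hom C x y"
    using assms by (auto simp: Iso_def)
  moreover from this have "g \<in> Iso C y x" unfolding Iso_def by blast
  ultimately show thesis using that[of g] by simp
qed

lemma IsoI:
  "\<lbrakk>src C f = x; trg C f = y; src C g = y; trg C g = x; g \<cdot> f = \<i> x; f \<cdot> g = \<i> y\<rbrakk>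
    \<Longrightarrow> f \<in> Iso C x y"
  by (auto simp: Iso_def)

lemma Iso_idm: "\<i> x \<in> Iso C x x"
  by (rule IsoI[of _ _ _ "\<i> x"]) simp_all

lemma Iso_comp:
  assumes "f \<in> Iso C x y" "g \<in> Iso C y z"
  shows "g \<cdot> f \<in> Iso C x z"
proof -
  obtain f' where f: "src C f = x" "trg C f = y" "src C f' = y" "trg C f' = x"
    "f' \<cdot> f = \<i> x" "f \<cdot> f' = \<i> y"
    using assms(1) by (rule IsoE)
  obtain g' where g: "src C g = y" "trg C g = z" "src C g' = z" "trg C g' = y"
    "g' \<cdot> g = \<i> y" "g \<cdot> g' = \<i> z"
    using assms(2) by (rule IsoE)
  show ?thesis
    by (rule IsoI[where g="f' \<cdot> g'"])
      (use f g in \<open>simp_all add: comp_cancel[OF g(5)] comp_cancel[OF f(6)]\<close>)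
qed

lemma isomorphic_sym: "isomorphic C x y \<Longrightarrow> isomorphic C y x"
  unfolding isomorphic_def ex_in_conv[symmetric] by (blast elim: IsoE)

lemma isomorphic_trans: "\<lbrakk>isomorphic C x y; isomorphic C y z\<rbrakk> \<Longrightarrow> isomorphic C x z"
  unfolding isomorphic_def using Iso_comp by blast

lemma Iso_cancel_right:
  assumes "f \<in> Iso C x y" "g \<cdot> f = zmor C x z" "src C g = y" "trg C g = z"
  shows "g = zmor C y z"
proof -
  obtain f' where f': "src C f = x" "trg C f = y" "src C f' = y" "trg C f' = x" "f \<cdot> f' = \<i> y"
    using assms(1) by (rule IsoE)
  have "(g \<cdot> f) \<cdot> f' = g" using f' assms(3) by simp
  then show ?thesis using f' assms(2) by simp
qed


subsection \<open>Zero objects\<close>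

text \<open>An equation between arrows, unlike the universal property, is visibly preserved by
  additive functors.\<close>

lemma zero_obj_iff: "zero_obj C z \<longleftrightarrow> \<i> z = zmor C z z"
proof
  assume "zero_obj C z"
  then have "\<exists>!f. f \<in> Hom C z z" by (auto simp: zero_obj_def)
  then show "\<i> z = zmor C z z" by (metis id_Hom in_Hom src_zmor trg_zmor)
next
  assume z: "\<i> z = zmor C z z"
  have "f = zmor C x z" if "src C f = x" "trg C f = z" for f x
    using idm_comp[of f z] that unfolding z by simp
  moreover have "f = zmor C z x" if "src C f = z" "trg C f = x" for f x
    using comp_idm[of f z] that unfolding z by simp
  ultimately show "zero_obj C z"
    unfolding zero_obj_def in_Hom by (metis src_zmor trg_zmor)
qed

lemma zmor_into_zero: "\<lbrakk>zero_obj C z; trg C f = z\<rbrakk> \<Longrightarrow> f = zmor C (src C f) z"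
  by (metis idm_comp zero_obj_iff zmor_comp)

lemma zmor_from_zero: "\<lbrakk>zero_obj C z; src C f = z\<rbrakk> \<Longrightarrow> f = zmor C z (trg C f)"
  by (metis comp_idm zero_obj_iff comp_zmor)

lemma zero_obj_retract:
  assumes "zero_obj C z" "p \<cdot> i = \<i> x" "src C i = x" "trg C i = z" "src C p = z" "trg C p = x"
  shows "zero_obj C x"
  using assms zmor_into_zero[of z i] by (metis comp_zmor zero_obj_iff)

lemma zero_obj_isomorphic: "\<lbrakk>isomorphic C x y; zero_obj C x\<rbrakk> \<Longrightarrow> zero_obj C y"
  unfolding isomorphic_def ex_in_conv[symmetric] by (metis IsoE zero_obj_retract)


subsection \<open>Coproducts\<close>

lemma coproductD:
  assumes "coproduct C I x c j" "i \<in> I"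
  shows "src C (j i) = x i" "trg C (j i) = c"
  using assms by (auto simp: coproduct_def)

lemma coproduct_ex:
  assumes "coproduct C I x c j" "\<And>i. i \<in> I \<Longrightarrow> src C (f i) = x i" "\<And>i. i \<in> I \<Longrightarrow> trg C (f i) = z"
  obtains h where "src C h = c" "trg C h = z" "\<And>i. i \<in> I \<Longrightarrow> h \<cdot> j i = f i"
proof -
  have "\<forall>i\<in>I. f i \<in> Hom C (x i) z" using assms by simp
  then have "\<exists>!h. h \<in> Hom C c z \<and> (\<forall>i\<in>I. h \<cdot> j i = f i)"
    using assms(1) unfolding coproduct_def by blast
  then show thesis using that by auto
qed

lemma coproduct_eqI:
  assumes "coproduct C I x c j" "src C g = c" "src C h = c" "trg C g = trg C h"
    "\<And>i. i \<in> I \<Longrightarrow> g \<cdot> j i = h \<cdot> j i"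
  shows "g = h"
proof -
  have "\<forall>i\<in>I. g \<cdot> j i \<in> Hom C (x i) (trg C g)"
    using assms coproductD[OF assms(1)] by simp
  then have "\<exists>!k. k \<in> Hom C c (trg C g) \<and> (\<forall>i\<in>I. k \<cdot> j i = g \<cdot> j i)"
    using assms(1)[unfolded coproduct_def, THEN conjunct2, rule_format, of "\<lambda>i. g \<cdot> j i" "trg C g"]
    by simp
  moreover have "g \<in> Hom C c (trg C g) \<and> (\<forall>i\<in>I. g \<cdot> j i = g \<cdot> j i)" using assms(2) by simp
  moreover have "h \<in> Hom C c (trg C g) \<and> (\<forall>i\<in>I. h \<cdot> j i = g \<cdot> j i)" using assms(3-5) by simp
  ultimately show ?thesis by blast
qed

lemma coproductI:
  assumes "\<And>i. i \<in> I \<Longrightarrow> src C (j i) = x i" "\<And>i. i \<in> I \<Longrightarrow> trg C (j i) = c"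
    and "\<And>z f. \<lbrakk>\<And>i. i \<in> I \<Longrightarrow> src C (f i) = x i; \<And>i. i \<in> I \<Longrightarrow> trg C (f i) = z\<rbrakk>
      \<Longrightarrow> \<exists>h. src C h = c \<and> trg C h = z \<and> (\<forall>i\<in>I. h \<cdot> j i = f i)"
    and "\<And>g h. \<lbrakk>src C g = c; src C h = c; trg C g = trg C h; \<And>i. i \<in> I \<Longrightarrow> g \<cdot> j i = h \<cdot> j i\<rbrakk>
      \<Longrightarrow> g = h"
  shows "coproduct C I x c j"
  unfolding coproduct_def
proof (intro conjI ballI allI impI)
  show "j i \<in> Hom C (x i) c" if "i \<in> I" for i using assms(1,2) that by simp
  fix z f assume f: "\<forall>i\<in>I. f i \<in> Hom C (x i) z"
  then obtain h where h: "src C h = c \<and> trg C h = z \<and> (\<forall>i\<in>I. h \<cdot> j i = f i)"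
    using assms(3)[of f z] by auto
  show "\<exists>!h. h \<in> Hom C c z \<and> (\<forall>i\<in>I. h \<cdot> j i = f i)"
  proof (rule ex1I)
    show "h \<in> Hom C c z \<and> (\<forall>i\<in>I. h \<cdot> j i = f i)" using h by simp
    show "k = h" if "k \<in> Hom C c z \<and> (\<forall>i\<in>I. k \<cdot> j i = f i)" for k
      by (rule assms(4)) (use that h in simp_all)
  qed
qed

text \<open>
  Compactness is restated without sums: an arrow into a coproduct factors through finitely many
  summands exactly when it is killed by an endomorphism of the coproduct that vanishes on finitely
  many summands and is the identity on the others.
\<close>

definition kills :: "'i set \<Rightarrow> 'o \<Rightarrow> ('i \<Rightarrow> 'm) \<Rightarrow> 'i set \<Rightarrow> 'm \<Rightarrow> bool" where
  "kills I c j F k \<longleftrightarrow> src C k = c \<and> trg C k = c \<and>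
     (\<forall>i\<in>I. k \<cdot> j i = (if i \<in> F then zmor C (src C (j i)) c else j i))"

lemma kills_ex:
  assumes "coproduct C I x c j"
  obtains k where "kills I c j F k"
proof -
  obtain k where "src C k = c" "trg C k = c"
    "\<And>i. i \<in> I \<Longrightarrow> k \<cdot> j i = (if i \<in> F then zmor C (src C (j i)) c else j i)"
    by (rule coproduct_ex[OF assms, of "\<lambda>i. if i \<in> F then zmor C (src C (j i)) c else j i" c])
      (auto simp: coproductD[OF assms])
  then show thesis using that[of k] by (simp add: kills_def)
qed

lemma kills_comp:
  assumes "coproduct C I x c j" "kills I c j F k" "kills I c j G l"
  shows "kills I c j (F \<union> G) (k \<cdot> l)"
proof -
  have kl: "src C k = c" "trg C k = c" "src C l = c" "trg C l = c"
    using assms(2,3) by (auto simp: kills_def)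
  have "(k \<cdot> l) \<cdot> j i = (if i \<in> F \<union> G then zmor C (src C (j i)) c else j i)" if i: "i \<in> I" for i
  proof -
    have "k \<cdot> j i = (if i \<in> F then zmor C (src C (j i)) c else j i)"
      "l \<cdot> j i = (if i \<in> G then zmor C (src C (j i)) c else j i)"
      using assms(2,3) i by (auto simp: kills_def)
    moreover have "trg C (j i) = c" using coproductD[OF assms(1) i] by simp
    ultimately show ?thesis using kl by simp
  qed
  then show ?thesis using kl by (simp add: kills_def)
qed

text \<open>An arrow out of a coproduct is determined on the summands. In
  \<open>compact_ten_rigid\<close> this identifies a killer on \<open>c \<odot> d\<close> with the
  image of a killer on \<open>c\<close>.\<close>

lemma kills_unique:
  assumes "coproduct C I x c j" "kills I c j F k" "kills I c j F l"
  shows "k = l"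
  by (rule coproduct_eqI[OF assms(1)]) (use assms in \<open>auto simp: kills_def\<close>)


subsection \<open>Compact objects\<close>

definition finitely_factoring :: "'u rel \<Rightarrow> 'o \<Rightarrow> bool" where
  "finitely_factoring \<kappa> x \<longleftrightarrow>
     (\<forall>(I :: 'u set) y c j f. small \<kappa> I \<and> coproduct C I y c j \<and> src C f = x \<and> trg C f = c \<longrightarrow>
        (\<exists>F k. finite F \<and> kills I c j F k \<and> k \<cdot> f = zmor C x c))"

lemma finitely_factoringD:
  fixes \<kappa> :: "'u rel" and I :: "'u set"
  assumes "finitely_factoring \<kappa> x" "small \<kappa> I" "coproduct C I y c j" "src C f = x" "trg C f = c"
  obtains F k where "finite F" "kills I c j F k" "src C k = c" "trg C k = c" "k \<cdot> f = zmor C x c"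
proof -
  obtain F k where "finite F" "kills I c j F k" "k \<cdot> f = zmor C x c"
    using assms(1)[unfolded finitely_factoring_def, rule_format, of I y c j f] assms(2-5) by blast
  then show thesis using that[of F k] by (simp add: kills_def)
qed

lemma comp_hom: "trg C g = w \<Longrightarrow> src C g = y
   \<Longrightarrow> (\<lambda>f. g \<cdot> f) \<in> hom (HomGrp C x y) (HomGrp C x w)"
  by (auto intro!: homI)

text \<open>\<open>gfinprod\<close> sees only the nonzero terms, so it is a finite sum over any
  finite \<open>F\<close> containing their indices, and composition distributes over finite sums.
  \<open>F\<close> may be larger than the set of those indices.\<close>

lemma gfinprod_comp:
  fixes f :: "'i \<Rightarrow> 'm"
  assumes "\<And>i. i \<in> I \<Longrightarrow> src C (f i) = x" "\<And>i. i \<in> I \<Longrightarrow> trg C (f i) = y" "finite F" "F \<subseteq> I"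
    "\<And>i. i \<in> I - F \<Longrightarrow> f i = zmor C x y" "src C k = y" "trg C k = w"
    "\<And>i. i \<in> F \<Longrightarrow> k \<cdot> f i = g i"
  shows "k \<cdot> gfinprod (HomGrp C x y) f I = finprod (HomGrp C x w) g F"
proof -
  interpret Y: comm_group "HomGrp C x y" by (rule Hom_comm_group)
  interpret W: comm_group "HomGrp C x w" by (rule Hom_comm_group)
  have "gfinprod (HomGrp C x y) f I = gfinprod (HomGrp C x y) f F"
    by (rule Y.gfinprod_mono_neutral_cong_right) (use assms in auto)
  also have "\<dots> = finprod (HomGrp C x y) f F"
    using assms by (intro Y.gfinprod_eq_finprod) auto
  finally have 1: "gfinprod (HomGrp C x y) f I = finprod (HomGrp C x y) f F" .
  have "k \<cdot> finprod (HomGrp C x y) f F = finprod (HomGrp C x w) g F"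
    if "finite F" "F \<subseteq> I" "\<And>i. i \<in> F \<Longrightarrow> k \<cdot> f i = g i" for F
    using that
  proof (induction F rule: finite_induct)
    case empty
    then show ?case using assms by simp
  next
    case (insert i F)
    have f: "f \<in> F \<rightarrow> carrier (HomGrp C x y)" using insert assms by auto
    have g: "g i' \<in> carrier (HomGrp C x w)" if "i' \<in> insert i F" for i'
    proof -
      have "i' \<in> I" using insert.prems(1) that by blast
      then show ?thesis unfolding insert.prems(2)[OF that, symmetric] using assms by simp
    qed
    have "finprod (HomGrp C x y) f F \<in> carrier (HomGrp C x y)"
      using f by (rule Y.finprod_closed)
    then show ?case using insert assms f g by (simp add: Pi_def)
  qed
  then show ?thesis using 1 assms by simp
qed

text \<open>Surjectivity of the canonical map writes \<open>f\<close> as the sum of the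
  \<open>j i \<cdot> \<phi> i\<close> with almost all \<open>\<phi> i\<close> zero; killing the
  remaining finitely many summands kills \<open>f\<close>.\<close>

lemma compact_imp_finitely_factoring:
  assumes "compact_obj \<kappa> C x"
  shows "finitely_factoring \<kappa> x"
  unfolding finitely_factoring_def
proof (intro allI impI, elim conjE)
  fix I :: "'a set" and y c j f
  assume *: "small \<kappa> I" "coproduct C I y c j" "src C f = x" "trg C f = c"
  note j = coproductD[OF *(2)]
  have "(\<lambda>\<phi>. gfinprod (HomGrp C x c) (\<lambda>i. j i \<cdot> \<phi> i) I)
          \<in> iso (sum_group I (\<lambda>i. HomGrp C x (y i))) (HomGrp C x c)"
    using assms * by (auto simp: compact_obj_def)
  moreover have "f \<in> carrier (HomGrp C x c)" using * by simp
  ultimately have "f \<in> (\<lambda>\<phi>. gfinprod (HomGrp C x c) (\<lambda>i. j i \<cdot> \<phi> i) I)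
      ` carrier (sum_group I (\<lambda>i. HomGrp C x (y i)))"
    by (simp add: iso_def bij_betw_def)
  then obtain \<phi> where \<phi>: "\<phi> \<in> carrier (sum_group I (\<lambda>i. HomGrp C x (y i)))"
      "gfinprod (HomGrp C x c) (\<lambda>i. j i \<cdot> \<phi> i) I = f"
    by blast
  define F where "F = {i \<in> I. \<phi> i \<noteq> zmor C x (y i)}"
  have F: "finite F" "F \<subseteq> I" and \<phi>': "\<And>i. i \<in> I \<Longrightarrow> src C (\<phi> i) = x \<and> trg C (\<phi> i) = y i"
    using \<phi>(1) by (auto simp: carrier_sum_group group_HomGrp F_def)
  obtain k where k: "kills I c j F k" by (rule kills_ex[OF *(2)])
  have kj: "k \<cdot> (j i \<cdot> \<phi> i) = zmor C x c" if "i \<in> F" for i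
    using k F(2) \<phi>' j that by (subst comp_cancel[of k "j i"]) (auto simp: kills_def)
  interpret comm_group "HomGrp C x c" by (rule Hom_comm_group)
  have "k \<cdot> f = finprod (HomGrp C x c) (\<lambda>i. zmor C x c) F"
    unfolding \<phi>(2)[symmetric]
    by (rule gfinprod_comp) (use F j \<phi>' k kj in \<open>auto simp: kills_def F_def\<close>)
  also have "\<dots> = zmor C x c" using finprod_one_eqI[of F "\<lambda>i. zmor C x c"] by simp
  finally show "\<exists>F k. finite F \<and> kills I c j F k \<and> k \<cdot> f = zmor C x c"
    using F(1) k by blast
qed

lemma coproduct_proj:
  assumes c: "coproduct C I y c j" and "i \<in> I"
  obtains p where "src C p = c" "trg C p = y i" "p \<cdot> j i = \<i> (y i)"
    "\<And>i'. i' \<in> I \<Longrightarrow> i' \<noteq> i \<Longrightarrow> p \<cdot> j i' = zmor C (y i') (y i)"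
proof -
  obtain p where "src C p = c" "trg C p = y i"
    "\<And>i'. i' \<in> I \<Longrightarrow> p \<cdot> j i' = (if i' = i then \<i> (y i) else zmor C (y i') (y i))"
    by (rule coproduct_ex[OF c, of "\<lambda>i'. if i' = i then \<i> (y i) else zmor C (y i') (y i)" "y i"])
      auto
  then show thesis using that[of p] assms(2) by simp
qed

text \<open>On every summand the identity of \<open>c\<close> agrees with \<open>k\<close> plus the
  sum of the \<open>j i \<cdot> p i\<close> over \<open>F\<close>. Composing with \<open>f\<close>,
  which \<open>k\<close> annihilates, leaves the finite sum.\<close>

lemma kills_complement:
  assumes c: "coproduct C I y c j" and "finite F" "F \<subseteq> I" "kills I c j F k"
    and p: "\<And>i. i \<in> F \<Longrightarrow> src C (p i) = c" "\<And>i. i \<in> F \<Longrightarrow> trg C (p i) = y i"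
      "\<And>i. i \<in> F \<Longrightarrow> p i \<cdot> j i = \<i> (y i)"
      "\<And>i i'. i \<in> F \<Longrightarrow> i' \<in> I \<Longrightarrow> i' \<noteq> i \<Longrightarrow> p i \<cdot> j i' = zmor C (y i') (y i)"
    and f: "src C f = x" "trg C f = c" "k \<cdot> f = zmor C x c"
  shows "f = finprod (HomGrp C x c) (\<lambda>i. j i \<cdot> (p i \<cdot> f)) F"
proof -
  note j = coproductD[OF c]
  \<comment> \<open>The term \<open>k \<cdot> f\<close> is kept here because the smaller killers met
    in the induction need not annihilate \<open>f\<close>.\<close>
  have "padd C (k \<cdot> f) (finprod (HomGrp C x c) (\<lambda>i. j i \<cdot> (p i \<cdot> f)) F) = f"
    if "finite F" "F \<subseteq> I" "kills I c j F k" "src C f = x" "trg C f = c"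
      "\<And>i. i \<in> F \<Longrightarrow> src C (p i) = c" "\<And>i. i \<in> F \<Longrightarrow> trg C (p i) = y i"
      "\<And>i. i \<in> F \<Longrightarrow> p i \<cdot> j i = \<i> (y i)"
      "\<And>i i'. i \<in> F \<Longrightarrow> i' \<in> I \<Longrightarrow> i' \<noteq> i \<Longrightarrow> p i \<cdot> j i' = zmor C (y i') (y i)" for F k
    using that
  proof (induction F arbitrary: k rule: finite_induct)
    case empty
    interpret comm_group "HomGrp C x c" by (rule Hom_comm_group)
    have "k = \<i> c"
      by (rule coproduct_eqI[OF c]) (use empty j in \<open>auto simp: kills_def\<close>)
    then show ?case using empty by simp
  next
    case (insert i F)
    interpret comm_group "HomGrp C x c" by (rule Hom_comm_group)
    obtain l where l: "kills I c j F l" by (rule kills_ex[OF c])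
    have l': "src C l = c" "trg C l = c" using l by (auto simp: kills_def)
    have k': "src C k = c" "trg C k = c" using insert.prems(2) by (auto simp: kills_def)
    have i: "i \<in> I" "src C (p i) = c" "trg C (p i) = y i" "src C (j i) = y i" "trg C (j i) = c"
      using insert.prems j by auto
    have S: "finprod (HomGrp C x c) (\<lambda>i. j i \<cdot> (p i \<cdot> f)) F \<in> carrier (HomGrp C x c)"
      using insert.prems j by (intro finprod_closed) auto
    \<comment> \<open>Killers of \<open>F\<close> and of \<open>insert i F\<close> differ by the
      projector onto the summand \<open>i\<close>.\<close>
    have "l = padd C k (j i \<cdot> p i)"
    proof (rule coproduct_eqI[OF c])
      fix i' assume i': "i' \<in> I"
      note i'j = j[OF i']
      have lj: "l \<cdot> j i' = (if i' \<in> F then zmor C (y i') c else j i')"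
        and kj: "k \<cdot> j i' = (if i' \<in> insert i F then zmor C (y i') c else j i')"
        using l insert.prems(2) i' i'j by (simp_all add: kills_def)
      have "p i \<cdot> j i' = (if i' = i then \<i> (y i) else zmor C (y i') (y i))"
        using insert.prems(7,8) i' by auto
      then have "padd C k (j i \<cdot> p i) \<cdot> j i'
          = padd C (k \<cdot> j i') (if i' = i then j i else zmor C (y i') c)"
        using i i'j k' by simp
      then show "l \<cdot> j i' = padd C k (j i \<cdot> p i) \<cdot> j i'"
        unfolding lj kj using insert.hyps(2) i'j i by simp
    qed (use l' k' i in auto)
    then have "l \<cdot> f = padd C (k \<cdot> f) (j i \<cdot> (p i \<cdot> f))"
      using insert.prems k' i by simp
    moreover have "padd C (l \<cdot> f) (finprod (HomGrp C x c) (\<lambda>i. j i \<cdot> (p i \<cdot> f)) F) = f"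
      using insert.prems by (intro insert.IH[OF _ l]) auto
    moreover have "finprod (HomGrp C x c) (\<lambda>i. j i \<cdot> (p i \<cdot> f)) (insert i F)
        = padd C (j i \<cdot> (p i \<cdot> f)) (finprod (HomGrp C x c) (\<lambda>i. j i \<cdot> (p i \<cdot> f)) F)"
      using insert.hyps insert.prems j by (subst finprod_insert) auto
    ultimately show ?case
      using m_assoc[of "k \<cdot> f" "j i \<cdot> (p i \<cdot> f)" "finprod (HomGrp C x c) (\<lambda>i. j i \<cdot> (p i \<cdot> f)) F"]
        S k' i insert.prems by simp
  qed
  note this[OF assms(2-4) f(1,2) p]
  moreover have "finprod (HomGrp C x c) (\<lambda>i. j i \<cdot> (p i \<cdot> f)) F \<in> carrier (HomGrp C x c)"
    using assms j by (intro comm_monoid.finprod_closed[OF comm_group.axioms(1)[OF Hom_comm_group]]) auto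
  ultimately show ?thesis using f by simp
qed

text \<open>Projections to the summands recover the components of a family from its sum, which gives
  injectivity. For surjectivity the components of \<open>f\<close> are its projections over the
  finite set supplied by a killer, and zero elsewhere.\<close>

lemma finitely_factoring_imp_compact:
  assumes "finitely_factoring \<kappa> x"
  shows "compact_obj \<kappa> C x"
  unfolding compact_obj_def
proof (intro allI impI, elim conjE)
  fix I :: "'a set" and y c j
  assume *: "small \<kappa> I" and c: "coproduct C I y c j"
  note j = coproductD[OF c]
  interpret comm_group "HomGrp C x c" by (rule Hom_comm_group)
  let ?h = "\<lambda>\<phi>. gfinprod (HomGrp C x c) (\<lambda>i. j i \<cdot> \<phi> i) I"
  let ?S = "sum_group I (\<lambda>i. HomGrp C x (y i))"
  have hom: "?h \<in> hom ?S (HomGrp C x c)"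
    using j by (intro hom_group_sum comp_hom group_HomGrp) auto
  interpret group_hom ?S "HomGrp C x c" ?h
    using hom by (auto simp: group_hom_def group_hom_axioms_def group_HomGrp)
  have one: "\<one>\<^bsub>?S\<^esub> = (\<lambda>i\<in>I. zmor C x (y i))"
    by (simp add: sum_group_def product_group_def)
  have "\<phi> = \<one>\<^bsub>?S\<^esub>" if \<phi>: "\<phi> \<in> carrier ?S" "?h \<phi> = zmor C x c" for \<phi>
  proof
    fix i
    define F where "F = {i \<in> I. \<phi> i \<noteq> zmor C x (y i)}"
    have F: "finite F" "F \<subseteq> I" and \<phi>': "\<And>i. i \<in> I \<Longrightarrow> src C (\<phi> i) = x \<and> trg C (\<phi> i) = y i"
      and ext: "\<phi> \<in> extensional I"
      using \<phi>(1) by (auto simp: carrier_sum_group group_HomGrp F_def PiE_def)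
    show "\<phi> i = \<one>\<^bsub>?S\<^esub> i"
    proof (cases "i \<in> I")
      case True
      obtain p where p: "src C p = c" "trg C p = y i" "p \<cdot> j i = \<i> (y i)"
        "\<And>i'. i' \<in> I \<Longrightarrow> i' \<noteq> i \<Longrightarrow> p \<cdot> j i' = zmor C (y i') (y i)"
        using coproduct_proj[OF c True] by blast
      have pj: "p \<cdot> (j i' \<cdot> \<phi> i') = (if i = i' then \<phi> i else zmor C x (y i))" if "i' \<in> I" for i'
        using that \<phi>' j p by (subst comp_cancel[of p "j i'" "if i' = i then \<i> (y i) else zmor C (y i') (y i)"]) auto
      interpret Y: comm_group "HomGrp C x (y i)" by (rule Hom_comm_group)
      \<comment> \<open>The index \<open>i\<close> is inserted because \<open>F\<close> misses it
        when \<open>\<phi> i\<close> is already zero.\<close>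
      have "p \<cdot> ?h \<phi> = finprod (HomGrp C x (y i)) (\<lambda>i'. if i = i' then \<phi> i else zmor C x (y i)) (insert i F)"
        by (rule gfinprod_comp[where y=c]) (use F True j \<phi>' p pj in \<open>auto simp: F_def\<close>)
      also have "\<dots> = \<phi> i"
        using Y.finprod_singleton[of i "insert i F" "\<lambda>_. \<phi> i", unfolded one_HomGrp] F True \<phi>' by simp
      finally show ?thesis using \<phi>(2) p True by (simp add: one)
    next
      case False
      then show ?thesis using ext by (simp add: one extensional_def)
    qed
  qed
  then have "inj_on ?h (carrier ?S)"
    unfolding inj_on_one_iff by (auto simp: one)
  moreover have "f \<in> ?h ` carrier ?S" if "f \<in> carrier (HomGrp C x c)" for f
  proof -
    have f: "src C f = x" "trg C f = c" using that by auto
    obtain F0 k where k: "finite F0" "kills I c j F0 k" "k \<cdot> f = zmor C x c"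
      using finitely_factoringD[OF assms * c f] by metis
    \<comment> \<open>A killer may list indices outside \<open>I\<close>, on which it imposes
      nothing.\<close>
    define F where "F = F0 \<inter> I"
    have F: "finite F" "F \<subseteq> I" "kills I c j F k" using k by (auto simp: F_def kills_def)
    let ?P = "\<lambda>i p. src C p = c \<and> trg C p = y i \<and> p \<cdot> j i = \<i> (y i) \<and>
      (\<forall>i'. i' \<in> I \<longrightarrow> i' \<noteq> i \<longrightarrow> p \<cdot> j i' = zmor C (y i') (y i))"
    have "\<exists>p. ?P i p" if "i \<in> F" for i
    proof -
      have "i \<in> I" using that F(2) by blast
      from coproduct_proj[OF c this] show ?thesis by blast
    qed
    then have "\<exists>p. \<forall>i\<in>F. ?P i (p i)" by (intro bchoice) blast
    then obtain p where p: "\<And>i. i \<in> F \<Longrightarrow> ?P i (p i)" by blast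
    define \<phi> where "\<phi> = (\<lambda>i\<in>I. if i \<in> F then p i \<cdot> f else zmor C x (y i))"
    have "\<phi> \<in> carrier ?S"
      using F p f by (auto simp: carrier_sum_group group_HomGrp \<phi>_def intro: finite_subset[OF _ F(1)])
    moreover have "?h \<phi> = f"
    proof -
      have "(\<lambda>i. j i \<cdot> \<phi> i) \<in> I \<rightarrow> carrier (HomGrp C x c)"
        using F p f j by (auto simp: \<phi>_def)
      then have "?h \<phi> \<in> carrier (HomGrp C x c)" by (rule gfinprod_closed)
      \<comment> \<open>Composing with the identity makes \<open>gfinprod_comp\<close> applicable;
        it then merely truncates the sum to \<open>F\<close>.\<close>
      then have "?h \<phi> = \<i> c \<cdot> ?h \<phi>" by simp
      also have "\<dots> = finprod (HomGrp C x c) (\<lambda>i. j i \<cdot> (p i \<cdot> f)) F"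
        by (rule gfinprod_comp) (use F p f j in \<open>auto simp: \<phi>_def\<close>)
      also have "\<dots> = f"
        by (rule kills_complement[OF c F, symmetric]) (use p f k in auto)
      finally show ?thesis .
    qed
    ultimately show ?thesis by blast
  qed
  then have "?h ` carrier ?S = carrier (HomGrp C x c)"
    using hom_carrier[OF hom] by blast
  ultimately show "?h \<in> iso ?S (HomGrp C x c)"
    using hom by (simp add: iso_def bij_betw_def)
qed

lemma compact_iff: "compact_obj \<kappa> C x \<longleftrightarrow> finitely_factoring \<kappa> x"
  using compact_imp_finitely_factoring finitely_factoring_imp_compact by blast

lemma zero_obj_compact: "zero_obj C z \<Longrightarrow> compact_obj \<kappa> C z"
  unfolding compact_iff finitely_factoring_def
proof (intro allI impI, elim conjE)
  fix I :: "'a set" and y c j f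
  assume z: "zero_obj C z" and c: "coproduct C I y c j" and f: "src C f = z" "trg C f = c"
  obtain k where k: "kills I c j {} k" by (rule kills_ex[OF c])
  show "\<exists>F k. finite F \<and> kills I c j F k \<and> k \<cdot> f = zmor C z c"
    using k zmor_from_zero[OF z, of "k \<cdot> f"] f
    by (intro exI[of _ "{}"] exI[of _ k]) (auto simp: kills_def)
qed

lemma compact_retract:
  assumes "compact_obj \<kappa> C s" "p \<cdot> i = \<i> x" "src C i = x" "trg C i = s" "src C p = s" "trg C p = x"
  shows "compact_obj \<kappa> C x"
  unfolding compact_iff finitely_factoring_def
proof (intro allI impI, elim conjE)
  fix I :: "'a set" and y c j f
  assume I: "small \<kappa> I" and c: "coproduct C I y c j" and f: "src C f = x" "trg C f = c"
  have "src C (f \<cdot> p) = s" "trg C (f \<cdot> p) = c" using f assms by auto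
  then obtain F k where k: "finite F" "kills I c j F k" "src C k = c" "trg C k = c"
      "k \<cdot> (f \<cdot> p) = zmor C s c"
    using finitely_factoringD[OF assms(1)[unfolded compact_iff] I c] by metis
  have "k \<cdot> f = (k \<cdot> (f \<cdot> p)) \<cdot> i" using k(3,4) f assms(2-6) by simp
  also have "\<dots> = zmor C x c" using assms k by simp
  finally show "\<exists>F k. finite F \<and> kills I c j F k \<and> k \<cdot> f = zmor C x c" using k by blast
qed

end


section \<open>Triangulated categories\<close>

context triangulated_category
begin

lemma src_susm [simp]: "src C (\<s> f) = \<S> (src C f)"
  and trg_susm [simp]: "trg C (\<s> f) = \<S> (trg C f)"
  using sus_Hom[of f "src C f" "trg C f"] by simp_all

lemma susm_comp: "trg C f = src C g \<Longrightarrow> \<s> (g \<cdot> f) = \<s> g \<cdot> \<s> f"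
  using sus_comp[of f "src C f" "trg C f" g "trg C g"] by simp

lemma susm_zmor [simp]: "\<s> (zmor C x y) = zmor C (\<S> x) (\<S> y)"
  using sus_add[of "zmor C x y" x y "zmor C x y"] by (intro padd_idem_imp_zmor) simp_all

lemma susm_inj: "\<lbrakk>\<s> f = \<s> g; src C f = src C g; trg C f = trg C g\<rbrakk> \<Longrightarrow> f = g"
  using sus_fully_faithful[of "src C g" "trg C g"] by (auto simp: bij_betw_def dest: inj_onD)

lemma susm_eq_zmorD:
  "\<s> f = zmor C (\<S> x) (\<S> y) \<Longrightarrow> src C f = x \<Longrightarrow> trg C f = y \<Longrightarrow> f = zmor C x y"
  by (rule susm_inj) simp_all

lemma susm_full:
  assumes "src C g = \<S> x" "trg C g = \<S> y"
  obtains f where "src C f = x" "trg C f = y" "\<s> f = g"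
proof -
  have "g \<in> \<s> ` Hom C x y"
    using sus_fully_faithful[of x y] assms by (simp add: bij_betw_def)
  then show thesis using that by auto
qed

text \<open>The suspension is an equivalence, so an object is a suspension only up to isomorphism;
  both directions are named so that arrows can be conjugated by them.\<close>

lemma desuspension:
  obtains x v v' where "src C v = \<S> x" "trg C v = y" "src C v' = y" "trg C v' = \<S> x"
    "v' \<cdot> v = \<i> (\<S> x)" "v \<cdot> v' = \<i> y"
proof -
  obtain x v where v: "v \<in> Iso C (\<S> x) y"
    using sus_ess_surj[of y] by (auto simp: isomorphic_def)
  show thesis by (rule IsoE[OF v]) (rule that)
qed

lemma zero_obj_sus: "zero_obj C z \<Longrightarrow> zero_obj C (\<S> z)"
  unfolding zero_obj_iff by (metis sus_id susm_zmor)

subsection \<open>Exact triangles\<close>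

lemma tri_types:
  assumes "(f, g, h) \<in> tri C"
  shows "src C g = trg C f" "src C h = trg C g" "trg C h = \<S> (src C f)"
  using tri_Hom[OF assms] by auto

lemma tri_rot:
  assumes "(f, g, h) \<in> tri C"
  shows "(g, h, neg C (\<s> f)) \<in> tri C"
  using tri_rotate[of f "src C f" "trg C f" g "trg C g" h] assms tri_types[OF assms] by simp

text \<open>The triangle on the identity of \<open>src C f\<close> maps to the given one by the
  identity and \<open>f\<close>, so \<open>g \<cdot> f\<close> factors through a zero
  object.\<close>

lemma tri_comp_zero:
  assumes "(f, g, h) \<in> tri C"
  shows "g \<cdot> f = zmor C (src C f) (trg C g)"
proof -
  obtain z where z: "zero_obj C z" using zero_exists by blast
  note t = tri_types[OF assms]
  have "\<exists>w\<in>Hom C z (trg C g). g \<cdot> f = w \<cdot> zmor C (src C f) z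
      \<and> h \<cdot> w = \<s> (\<i> (src C f)) \<cdot> zmor C z (\<S> (src C f))"
    by (rule tri_morphism[OF tri_id[OF z, of "src C f"] assms]) (use t in auto)
  then show ?thesis by auto
qed

lemma tri_weak_cokernel:
  assumes tri: "(f, g, h) \<in> tri C" and k: "src C k = trg C f" "k \<cdot> f = zmor C (src C f) (trg C k)"
  obtains \<theta> where "src C \<theta> = trg C g" "trg C \<theta> = trg C k" "k = \<theta> \<cdot> g"
proof -
  obtain z where z: "zero_obj C z" using zero_exists by blast
  note t = tri_types[OF tri]
  let ?w = "trg C k"
  \<comment> \<open>The zero object of the identity triangle is taken to be \<open>\<S> z\<close>,
    and its zero arrow is written with a sign, so that the triangle has the shape of a rotated one
    and can be rotated back.\<close>
  have "(\<i> ?w, zmor C ?w (\<S> z), neg C (\<s> (zmor C z ?w))) \<in> tri C"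
    using tri_id[OF zero_obj_sus[OF z], of ?w] by simp
  then have "(zmor C z ?w, \<i> ?w, zmor C ?w (\<S> z)) \<in> tri C"
    using tri_rotate[of "zmor C z ?w" z ?w "\<i> ?w" ?w "zmor C ?w (\<S> z)"] by simp
  then have "\<exists>\<theta>\<in>Hom C (trg C g) ?w. \<i> ?w \<cdot> k = \<theta> \<cdot> g
      \<and> zmor C ?w (\<S> z) \<cdot> \<theta> = \<s> (zmor C (src C f) z) \<cdot> h"
    by (rule tri_morphism[OF tri]) (use t k in auto)
  then obtain \<theta> where "src C \<theta> = trg C g" "trg C \<theta> = ?w" "\<i> ?w \<cdot> k = \<theta> \<cdot> g"
    by auto
  moreover have "\<i> ?w \<cdot> k = k" by simp
  ultimately show thesis using that[of \<theta>] by argo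
qed


subsection \<open>Compact objects\<close>

text \<open>An equivalence preserves coproducts: the target is replaced by an isomorphic suspension,
  then fullness gives the mediating arrow and faithfulness its uniqueness.\<close>

lemma coproduct_sus:
  assumes c: "coproduct C I y c j"
  shows "coproduct C I (\<lambda>i. \<S> (y i)) (\<S> c) (\<lambda>i. \<s> (j i))"
proof (rule coproductI)
  note j = coproductD[OF c]
  show "src C (\<s> (j i)) = \<S> (y i)" "trg C (\<s> (j i)) = \<S> c" if "i \<in> I" for i
    using j that by auto
  show "\<exists>h. src C h = \<S> c \<and> trg C h = z \<and> (\<forall>i\<in>I. h \<cdot> \<s> (j i) = f i)"
    if f: "\<And>i. i \<in> I \<Longrightarrow> src C (f i) = \<S> (y i)" "\<And>i. i \<in> I \<Longrightarrow> trg C (f i) = z" for z f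
  proof -
    obtain z' v v' where v: "src C v = \<S> z'" "trg C v = z" "src C v' = z" "trg C v' = \<S> z'"
      "v' \<cdot> v = \<i> (\<S> z')" "v \<cdot> v' = \<i> z"
      by (rule desuspension)
    have "\<exists>f'. src C f' = y i \<and> trg C f' = z' \<and> \<s> f' = v' \<cdot> f i" if "i \<in> I" for i
      by (rule susm_full[of "v' \<cdot> f i" "y i" z']) (use f[OF that] v in auto)
    then have "\<exists>f'. \<forall>i\<in>I. src C (f' i) = y i \<and> trg C (f' i) = z' \<and> \<s> (f' i) = v' \<cdot> f i"
      by (intro bchoice) blast
    then obtain f' where f': "\<And>i. i \<in> I \<Longrightarrow> src C (f' i) = y i"
      "\<And>i. i \<in> I \<Longrightarrow> trg C (f' i) = z'" "\<And>i. i \<in> I \<Longrightarrow> \<s> (f' i) = v' \<cdot> f i"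
      by blast
    obtain h where h: "src C h = c" "trg C h = z'" "\<And>i. i \<in> I \<Longrightarrow> h \<cdot> j i = f' i"
      by (rule coproduct_ex[OF c, of f' z']) (use f' in auto)
    have "(v \<cdot> \<s> h) \<cdot> \<s> (j i) = f i" if i: "i \<in> I" for i
    proof -
      have "(v \<cdot> \<s> h) \<cdot> \<s> (j i) = v \<cdot> \<s> (h \<cdot> j i)"
        using v h(1,2) j[OF i] by (simp add: susm_comp)
      also have "\<dots> = v \<cdot> (v' \<cdot> f i)" using h f' i by simp
      also have "\<dots> = f i" using v f[OF i] by (simp add: comp_cancel[OF v(6)])
      finally show ?thesis .
    qed
    then show ?thesis using v h(1,2) by (intro exI[of _ "v \<cdot> \<s> h"]) simp
  qed
  show "g = h" if gh: "src C g = \<S> c" "src C h = \<S> c" "trg C g = trg C h"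
    "\<And>i. i \<in> I \<Longrightarrow> g \<cdot> \<s> (j i) = h \<cdot> \<s> (j i)" for g h
  proof -
    obtain z' v v' where v: "src C v = \<S> z'" "trg C v = trg C h" "src C v' = trg C h"
      "trg C v' = \<S> z'" "v' \<cdot> v = \<i> (\<S> z')" "v \<cdot> v' = \<i> (trg C h)"
      by (rule desuspension)
    obtain g' where g': "src C g' = c" "trg C g' = z'" "\<s> g' = v' \<cdot> g"
      by (rule susm_full[of "v' \<cdot> g" c z']) (use v gh in auto)
    obtain h' where h': "src C h' = c" "trg C h' = z'" "\<s> h' = v' \<cdot> h"
      by (rule susm_full[of "v' \<cdot> h" c z']) (use v gh in auto)
    have "g' \<cdot> j i = h' \<cdot> j i" if i: "i \<in> I" for i
      by (rule susm_inj) (use g' h' v gh i j[OF i] in \<open>simp_all add: susm_comp\<close>)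
    then have "g' = h'"
      by (intro coproduct_eqI[OF c, of g' h']) (use g' h' in simp_all)
    then have "v \<cdot> (v' \<cdot> g) = v \<cdot> (v' \<cdot> h)" using g' h' by simp
    then show ?thesis using v gh by (simp add: comp_cancel[OF v(6)])
  qed
qed

text \<open>A fully faithful functor reflects coproducts.\<close>

lemma coproduct_desus:
  assumes c: "coproduct C I (\<lambda>i. \<S> (y i)) (\<S> c) (\<lambda>i. \<s> (j i))"
    and j: "\<And>i. i \<in> I \<Longrightarrow> src C (j i) = y i" "\<And>i. i \<in> I \<Longrightarrow> trg C (j i) = c"
  shows "coproduct C I y c j"
proof (rule coproductI)
  show "\<exists>h. src C h = c \<and> trg C h = z \<and> (\<forall>i\<in>I. h \<cdot> j i = f i)"
    if f: "\<And>i. i \<in> I \<Longrightarrow> src C (f i) = y i" "\<And>i. i \<in> I \<Longrightarrow> trg C (f i) = z" for z f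
  proof -
    obtain h where h: "src C h = \<S> c" "trg C h = \<S> z" "\<And>i. i \<in> I \<Longrightarrow> h \<cdot> \<s> (j i) = \<s> (f i)"
      by (rule coproduct_ex[OF c, of "\<lambda>i. \<s> (f i)" "\<S> z"]) (use f in auto)
    obtain h' where h': "src C h' = c" "trg C h' = z" "\<s> h' = h"
      by (rule susm_full[OF h(1,2)])
    have "h' \<cdot> j i = f i" if i: "i \<in> I" for i
      by (rule susm_inj) (use h' h(3)[OF i] f[OF i] j[OF i] in \<open>simp_all add: susm_comp\<close>)
    then show ?thesis using h' by blast
  qed
  show "g = h" if gh: "src C g = c" "src C h = c" "trg C g = trg C h"
    "\<And>i. i \<in> I \<Longrightarrow> g \<cdot> j i = h \<cdot> j i" for g h
  proof -
    have "\<s> g \<cdot> \<s> (j i) = \<s> h \<cdot> \<s> (j i)" if i: "i \<in> I" for i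
      using gh(1-3) gh(4)[OF i] j[OF i] by (metis susm_comp)
    then have "\<s> g = \<s> h"
      by (intro coproduct_eqI[OF c, of "\<s> g" "\<s> h"]) (use gh in simp_all)
    then show ?thesis by (rule susm_inj) (use gh in simp_all)
  qed
qed (use j in auto)

text \<open>The suspended coproduct has a killer for \<open>\<s> f\<close>; fullness brings it back
  to \<open>c\<close>, and faithfulness keeps its equations.\<close>

lemma compact_desus:
  fixes \<kappa> :: "'u rel"
  assumes "compact_obj \<kappa> C (\<S> x)"
  shows "compact_obj \<kappa> C x"
  unfolding compact_iff finitely_factoring_def
proof (intro allI impI, elim conjE)
  fix I :: "'u set" and y c j f
  assume I: "small \<kappa> I" and c: "coproduct C I y c j" and f: "src C f = x" "trg C f = c"
  note j = coproductD[OF c]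
  have "src C (\<s> f) = \<S> x" "trg C (\<s> f) = \<S> c" using f by auto
  then obtain F k where k: "finite F" "kills I (\<S> c) (\<lambda>i. \<s> (j i)) F k" "src C k = \<S> c"
      "trg C k = \<S> c" "k \<cdot> \<s> f = zmor C (\<S> x) (\<S> c)"
    by (rule finitely_factoringD[OF assms[unfolded compact_iff] I coproduct_sus[OF c]])
  obtain k' where k': "src C k' = c" "trg C k' = c" "\<s> k' = k"
    by (rule susm_full[OF k(3,4)])
  have "k' \<cdot> j i = (if i \<in> F then zmor C (src C (j i)) c else j i)" if i: "i \<in> I" for i
  proof (rule susm_inj)
    have "k \<cdot> \<s> (j i) = (if i \<in> F then zmor C (\<S> (y i)) (\<S> c) else \<s> (j i))"
      using k(2) i j[OF i] by (simp add: kills_def)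
    then show "\<s> (k' \<cdot> j i) = \<s> (if i \<in> F then zmor C (src C (j i)) c else j i)"
      using k' j[OF i] by (simp add: susm_comp)
  qed (use k' j[OF i] in simp_all)
  then have "kills I c j F k'" using k' by (simp add: kills_def)
  moreover have "k' \<cdot> f = zmor C x c"
    by (rule susm_eq_zmorD) (use k k' f in \<open>simp_all add: susm_comp\<close>)
  ultimately show "\<exists>F k. finite F \<and> kills I c j F k \<and> k \<cdot> f = zmor C x c"
    using k(1) by blast
qed

text \<open>The given coproduct is not literally a suspended one, so \<open>c\<close> and all
  summands are desuspended up to chosen isomorphisms, compactness of \<open>x\<close> is applied
  there, and the killer is conjugated back.\<close>

lemma compact_sus:
  fixes \<kappa> :: "'u rel"
  assumes "compact_obj \<kappa> C x"
  shows "compact_obj \<kappa> C (\<S> x)"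
  unfolding compact_iff finitely_factoring_def
proof (intro allI impI, elim conjE)
  fix I :: "'u set" and y c j f
  assume I: "small \<kappa> I" and c: "coproduct C I y c j" and f: "src C f = \<S> x" "trg C f = c"
  note j = coproductD[OF c]
  obtain c' v v' where v: "src C v = \<S> c'" "trg C v = c" "src C v' = c"
      "trg C v' = \<S> c'" "v' \<cdot> v = \<i> (\<S> c')" "v \<cdot> v' = \<i> c"
    by (rule desuspension)
  have "\<exists>y' w w'. src C w = \<S> y' \<and> trg C w = y i \<and> src C w' = y i \<and> trg C w' = \<S> y'
      \<and> w' \<cdot> w = \<i> (\<S> y') \<and> w \<cdot> w' = \<i> (y i)" for i
    by (rule desuspension[of "y i"]) blast
  then obtain y' w w' where w: "\<And>i. src C (w i) = \<S> (y' i)" "\<And>i. trg C (w i) = y i"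
      "\<And>i. src C (w' i) = y i" "\<And>i. trg C (w' i) = \<S> (y' i)"
      "\<And>i. w' i \<cdot> w i = \<i> (\<S> (y' i))" "\<And>i. w i \<cdot> w' i = \<i> (y i)"
    by metis
  have "\<exists>j'. src C j' = y' i \<and> trg C j' = c' \<and> \<s> j' = v' \<cdot> (j i \<cdot> w i)" if i: "i \<in> I" for i
    by (rule susm_full[of "v' \<cdot> (j i \<cdot> w i)" "y' i" c']) (use j[OF i] v w in auto)
  then have "\<exists>j'. \<forall>i\<in>I. src C (j' i) = y' i \<and> trg C (j' i) = c' \<and> \<s> (j' i) = v' \<cdot> (j i \<cdot> w i)"
    by (intro bchoice) blast
  then obtain j' where j': "\<And>i. i \<in> I \<Longrightarrow> src C (j' i) = y' i"
    "\<And>i. i \<in> I \<Longrightarrow> trg C (j' i) = c'" "\<And>i. i \<in> I \<Longrightarrow> \<s> (j' i) = v' \<cdot> (j i \<cdot> w i)"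
    by blast
  have "coproduct C I (\<lambda>i. \<S> (y' i)) (\<S> c') (\<lambda>i. \<s> (j' i))"
  proof (rule coproductI)
    show "\<exists>h. src C h = \<S> c' \<and> trg C h = z \<and> (\<forall>i\<in>I. h \<cdot> \<s> (j' i) = g i)"
      if g: "\<And>i. i \<in> I \<Longrightarrow> src C (g i) = \<S> (y' i)" "\<And>i. i \<in> I \<Longrightarrow> trg C (g i) = z" for z g
    proof -
      obtain h where h: "src C h = c" "trg C h = z" "\<And>i. i \<in> I \<Longrightarrow> h \<cdot> j i = g i \<cdot> w' i"
        by (rule coproduct_ex[OF c, of "\<lambda>i. g i \<cdot> w' i" z]) (use g w in auto)
      have "(h \<cdot> v) \<cdot> \<s> (j' i) = g i" if i: "i \<in> I" for i
      proof -
        have "(h \<cdot> v) \<cdot> \<s> (j' i) = h \<cdot> (v \<cdot> (v' \<cdot> (j i \<cdot> w i)))"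
          using h(1,2) v w j[OF i] j'[OF i] by simp
        also have "\<dots> = (h \<cdot> j i) \<cdot> w i"
          using h(1,2) v(1-4) w j[OF i] by (simp add: comp_cancel[OF v(6)])
        also have "\<dots> = g i" using h(3)[OF i] g[OF i] w by simp
        finally show ?thesis .
      qed
      then show ?thesis using h(1,2) v by (intro exI[of _ "h \<cdot> v"]) simp
    qed
    show "g = h" if gh: "src C g = \<S> c'" "src C h = \<S> c'" "trg C g = trg C h"
      "\<And>i. i \<in> I \<Longrightarrow> g \<cdot> \<s> (j' i) = h \<cdot> \<s> (j' i)" for g h
    proof -
      have "(g \<cdot> v') \<cdot> j i = (h \<cdot> v') \<cdot> j i" if i: "i \<in> I" for i
      proof -
        have "(g \<cdot> \<s> (j' i)) \<cdot> w' i = (h \<cdot> \<s> (j' i)) \<cdot> w' i" using gh(4)[OF i] by simp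
        then show ?thesis using gh(1-3) v(1-4) w j[OF i] j'[OF i] by simp
      qed
      then have "g \<cdot> v' = h \<cdot> v'"
        by (intro coproduct_eqI[OF c, of "g \<cdot> v'" "h \<cdot> v'"]) (use gh(1-3) v in simp_all)
      then have "(g \<cdot> v') \<cdot> v = (h \<cdot> v') \<cdot> v" by simp
      then show ?thesis using gh(1-3) v by simp
    qed
  qed (use j'(1,2) in auto)
  then have c': "coproduct C I y' c' j'" using j'(1,2) by (rule coproduct_desus)
  obtain f' where f': "src C f' = x" "trg C f' = c'" "\<s> f' = v' \<cdot> f"
    by (rule susm_full[of "v' \<cdot> f" x c']) (use f v in auto)
  obtain F k where k: "finite F" "kills I c' j' F k" "src C k = c'" "trg C k = c'"
      "k \<cdot> f' = zmor C x c'"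
    by (rule finitely_factoringD[OF assms[unfolded compact_iff] I c' f'(1,2)])
  \<comment> \<open>The suspended killer, carried from \<open>\<S> c'\<close> to \<open>c\<close>
    along \<open>v\<close>.\<close>
  define l where "l = v \<cdot> (\<s> k \<cdot> v')"
  have l: "src C l = c" "trg C l = c" using v k(3,4) by (simp_all add: l_def)
  have "l \<cdot> j i = (if i \<in> F then zmor C (src C (j i)) c else j i)" if i: "i \<in> I" for i
  proof -
    have "k \<cdot> j' i = (if i \<in> F then zmor C (y' i) c' else j' i)"
      using k(2) i j'[OF i] by (simp add: kills_def)
    then have eq: "\<s> k \<cdot> \<s> (j' i) = (if i \<in> F then zmor C (\<S> (y' i)) (\<S> c') else \<s> (j' i))"
      using k(3,4) j'(1,2)[OF i] by (simp flip: susm_comp)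
    have "(l \<cdot> j i) \<cdot> w i = v \<cdot> (\<s> k \<cdot> \<s> (j' i))"
      using k(3,4) j'[OF i] v w j[OF i] by (simp add: l_def)
    also have "\<dots> = (if i \<in> F then zmor C (\<S> (y' i)) c else j i \<cdot> w i)"
      unfolding eq using j'[OF i] v w j[OF i] by (simp add: comp_cancel[OF v(6)])
    finally have "((l \<cdot> j i) \<cdot> w i) \<cdot> w' i
        = (if i \<in> F then zmor C (\<S> (y' i)) c else j i \<cdot> w i) \<cdot> w' i" by simp
    then show ?thesis using l w j[OF i] by (simp split: if_splits)
  qed
  then have "kills I c j F l" using l by (simp add: kills_def)
  moreover have "l \<cdot> f = v \<cdot> \<s> (k \<cdot> f')"
    using f v f' k(3,4) by (simp add: l_def susm_comp)
  then have "l \<cdot> f = zmor C (\<S> x) c" using k(5) v by simp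
  ultimately show "\<exists>F k. finite F \<and> kills I c j F k \<and> k \<cdot> f = zmor C (\<S> x) c"
    using k(1) by blast
qed

text \<open>Two killers are needed. The first annihilates \<open>a \<cdot> g\<close>, so after it
  \<open>a\<close> factors through \<open>h\<close>; the second annihilates the resulting arrow out
  of \<open>\<S> (src C f)\<close>. Their composite kills the union of both finite sets.\<close>

lemma compact_cone:
  fixes \<kappa> :: "'u rel"
  assumes tri: "(f, g, h) \<in> tri C" and "compact_obj \<kappa> C (src C f)" "compact_obj \<kappa> C (trg C f)"
  shows "compact_obj \<kappa> C (trg C g)"
  unfolding compact_iff finitely_factoring_def
proof (intro allI impI, elim conjE)
  fix I :: "'u set" and y c j a
  assume I: "small \<kappa> I" and c: "coproduct C I y c j" and a: "src C a = trg C g" "trg C a = c"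
  note t = tri_types[OF tri] tri_types[OF tri_rot[OF tri]]
  have "src C (a \<cdot> g) = trg C f" "trg C (a \<cdot> g) = c" using a t by auto
  then obtain F k where k: "finite F" "kills I c j F k" "src C k = c" "trg C k = c"
      "k \<cdot> (a \<cdot> g) = zmor C (trg C f) c"
    by (rule finitely_factoringD[OF assms(3)[unfolded compact_iff] I c])
  have "src C (k \<cdot> a) = trg C g" "(k \<cdot> a) \<cdot> g = zmor C (src C g) (trg C (k \<cdot> a))"
    using k a t by simp_all
  then obtain \<theta> where \<theta>: "src C \<theta> = trg C h" "trg C \<theta> = trg C (k \<cdot> a)" "k \<cdot> a = \<theta> \<cdot> h"
    by (rule tri_weak_cokernel[OF tri_rot[OF tri]])
  have \<theta>': "src C \<theta> = \<S> (src C f)" "trg C \<theta> = c" using \<theta>(1,2) t k(3,4) a by auto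
  then obtain G l where l: "finite G" "kills I c j G l" "src C l = c" "trg C l = c"
      "l \<cdot> \<theta> = zmor C (\<S> (src C f)) c"
    by (rule finitely_factoringD[OF compact_sus[OF assms(2), unfolded compact_iff] I c])
  have "(l \<cdot> k) \<cdot> a = l \<cdot> (\<theta> \<cdot> h)" using \<theta>(3)[symmetric] l k a by simp
  also have "\<dots> = (l \<cdot> \<theta>) \<cdot> h" using \<theta>' l(3,4) t by simp
  also have "\<dots> = zmor C (trg C g) c" unfolding l(5) using t by simp
  finally show "\<exists>F k. finite F \<and> kills I c j F k \<and> k \<cdot> a = zmor C (trg C g) c"
    using k(1) l(1) kills_comp[OF c l(2) k(2)] by blast
qed


subsection \<open>Thick subcategories\<close>

lemma triangulated_subcategoryI:
  assumes "L \<noteq> {}" "\<And>x y. \<lbrakk>x \<in> L; isomorphic C x y\<rbrakk> \<Longrightarrow> y \<in> L" "\<And>x. \<S> x \<in> L \<longleftrightarrow> x \<in> L"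
    "\<And>f g h. \<lbrakk>(f, g, h) \<in> tri C; src C f \<in> L; trg C f \<in> L\<rbrakk> \<Longrightarrow> trg C g \<in> L"
  shows "triangulated_subcategory C L"
  using assms unfolding triangulated_subcategory_def by (auto simp: Hom_def)

lemma triangulated_isomorphic:
  "\<lbrakk>triangulated_subcategory C L; x \<in> L; isomorphic C x y\<rbrakk> \<Longrightarrow> y \<in> L"
  unfolding triangulated_subcategory_def by blast

lemma triangulated_sus_iff: "triangulated_subcategory C L \<Longrightarrow> \<S> x \<in> L \<longleftrightarrow> x \<in> L"
  unfolding triangulated_subcategory_def by blast

lemma triangulated_cone:
  assumes "triangulated_subcategory C L" "(f, g, h) \<in> tri C" "src C f \<in> L" "trg C f \<in> L"
  shows "trg C g \<in> L"
proof -
  have "f \<in> Hom C (src C f) (trg C f)" "g \<in> Hom C (trg C f) (trg C g)"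
    using tri_types[OF assms(2)] by auto
  then show ?thesis using assms unfolding triangulated_subcategory_def by blast
qed

text \<open>After two rotations, the suspension of the middle object is the cone of an arrow from
  \<open>trg C g\<close> to \<open>\<S> (src C f)\<close>.\<close>

lemma triangulated_extension:
  assumes L: "triangulated_subcategory C L" and tri: "(f, g, h) \<in> tri C"
    and "src C f \<in> L" "trg C g \<in> L"
  shows "trg C f \<in> L"
proof -
  note r = tri_rot[OF tri_rot[OF tri]]
  have "src C h \<in> L" "trg C h \<in> L"
    using tri_types[OF tri] assms(3,4) triangulated_sus_iff[OF L] by auto
  then have "trg C (neg C (\<s> f)) \<in> L" by (rule triangulated_cone[OF L r])
  then show ?thesis using triangulated_sus_iff[OF L] by simp
qed

lemma triangulated_zero:
  assumes "triangulated_subcategory C L" "zero_obj C z"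
  shows "z \<in> L"
proof -
  obtain x where "x \<in> L" using assms(1) unfolding triangulated_subcategory_def by blast
  then show ?thesis
    using triangulated_cone[OF assms(1) tri_id[OF assms(2), of x]] by simp
qed

text \<open>The cone of the inclusion of a summand \<open>x\<close> of \<open>s\<close> is the complement \<open>y\<close>: the
  inclusion splits, so the third arrow of the triangle vanishes and the second one is epi.\<close>

lemma triangulated_biproduct:
  assumes L: "triangulated_subcategory C L" and "x \<in> L" "y \<in> L" and b: "biproduct C x y s i j p q"
  shows "s \<in> L"
proof -
  have b: "src C i = x" "trg C i = s" "src C j = y" "trg C j = s" "src C p = s" "trg C p = x"
    "src C q = s" "trg C q = y" "p \<cdot> i = \<i> x" "q \<cdot> j = \<i> y" "p \<cdot> j = zmor C y x" "q \<cdot> i = zmor C x y"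
    "padd C (i \<cdot> p) (j \<cdot> q) = \<i> s"
    using b by (auto simp: biproduct_def)
  obtain g h where tri: "(i, g, h) \<in> tri C" using tri_cone[of i x s] b by auto
  note t = tri_types[OF tri]
  have gi: "g \<cdot> i = zmor C x (trg C g)" using tri_comp_zero[OF tri] b by simp
  have "neg C (\<s> i) \<cdot> h = zmor C (trg C g) (\<S> s)"
    using tri_comp_zero[OF tri_rot[OF tri_rot[OF tri]]] t b by simp
  then have ih: "\<s> i \<cdot> h = zmor C (trg C g) (\<S> s)"
    using neg_comp_eq_zmor[of "\<s> i" h] t b by simp
  \<comment> \<open>The composite \<open>\<s> i \<cdot> h\<close> vanishes, and
    \<open>\<s> p\<close> is a left inverse of \<open>\<s> i\<close>.\<close>
  have "h = \<s> (p \<cdot> i) \<cdot> h" using b t sus_id by simp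
  also have "\<dots> = \<s> p \<cdot> (\<s> i \<cdot> h)" using b(1-8) t by (simp add: susm_comp)
  finally have h0: "h = zmor C (trg C g) (\<S> x)" using ih b by simp
  have epi: "k = l" if kl: "src C k = trg C g" "src C l = trg C g" "trg C k = trg C l"
    "k \<cdot> g = l \<cdot> g" for k l
  proof -
    let ?d = "padd C k (neg C l)"
    have "padd C l (neg C l) \<cdot> g = padd C (l \<cdot> g) (neg C l \<cdot> g)"
      by (rule padd_comp) (use kl t in auto)
    moreover have "?d \<cdot> g = padd C (k \<cdot> g) (neg C l \<cdot> g)"
      by (rule padd_comp) (use kl t in auto)
    ultimately have "src C ?d = trg C g" "?d \<cdot> g = zmor C (src C g) (trg C ?d)"
      using kl t b(1,2) by simp_all
    then obtain \<theta> where \<theta>: "src C \<theta> = trg C h" "trg C \<theta> = trg C ?d" "?d = \<theta> \<cdot> h"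
      by (rule tri_weak_cokernel[OF tri_rot[OF tri]])
    have "?d = \<theta> \<cdot> zmor C (trg C g) (\<S> x)" using \<theta>(3) h0 by simp
    then have d: "?d = zmor C (trg C g) (trg C l)"
      using \<theta>(1,2) t b(1) kl by simp
    interpret group "HomGrp C (trg C g) (trg C l)" by (rule group_HomGrp)
    show ?thesis using d kl right_cancel[of "neg C l" k l] by simp
  qed
  have "src C q = trg C i" "q \<cdot> i = zmor C (src C i) (trg C q)" using b by simp_all
  then obtain \<theta> where \<theta>: "src C \<theta> = trg C g" "trg C \<theta> = trg C q" "q = \<theta> \<cdot> g"
    by (rule tri_weak_cokernel[OF tri])
  \<comment> \<open>Expanding the identity of \<open>s\<close> and using
    \<open>g \<cdot> i = 0\<close> leaves
    \<open>g = (g \<cdot> j) \<cdot> \<theta> \<cdot> g\<close>; cancelling the epi \<open>g\<close>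
    makes \<open>\<theta>\<close> inverse to \<open>g \<cdot> j\<close>.\<close>
  have "g = g \<cdot> padd C (i \<cdot> p) (j \<cdot> q)" unfolding b(13) using b(2) t by simp
  also have "\<dots> = padd C ((g \<cdot> i) \<cdot> p) (g \<cdot> (j \<cdot> q))" using b(1-8) t by simp
  also have "\<dots> = (g \<cdot> j) \<cdot> q" unfolding gi using b(1-8) t by simp
  also have "\<dots> = (g \<cdot> j) \<cdot> (\<theta> \<cdot> g)" using \<theta>(3) by simp
  finally have 0: "((g \<cdot> j) \<cdot> \<theta>) \<cdot> g = \<i> (trg C g) \<cdot> g" using b(1-8) t \<theta>(1,2) by simp
  have 1: "(g \<cdot> j) \<cdot> \<theta> = \<i> (trg C g)"
    by (rule epi[OF _ _ _ 0]) (use b(1-8) t \<theta>(1,2) in auto)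
  have "(\<theta> \<cdot> g) \<cdot> j = \<i> y" using \<theta>(3) b(10) by simp
  then have "\<theta> \<cdot> (g \<cdot> j) = \<i> y" using \<theta>(1,2) b(1-8) t by simp
  then have "g \<cdot> j \<in> Iso C y (trg C g)"
    by (intro IsoI[of _ _ _ \<theta>]) (use 1 \<theta>(1,2) b(1-8) t in auto)
  then have "trg C g \<in> L"
    using triangulated_isomorphic[OF L \<open>y \<in> L\<close>] unfolding isomorphic_def by blast
  then show ?thesis using triangulated_extension[OF L tri] \<open>x \<in> L\<close> b by simp
qed

text \<open>\<open>direct_summand\<close> speaks of the first summand, so the other one is reached
  by swapping. The equivalence makes the basic open sets of the spectrum closed under
  intersection.\<close>

lemma thick_biproduct_iff:
  assumes L: "thick_subcategory C L" and b: "biproduct C x y s i j p q"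
  shows "s \<in> L \<longleftrightarrow> x \<in> L \<and> y \<in> L"
proof
  have "biproduct C y x s j i q p"
  proof -
    have b': "src C i = x" "trg C i = s" "src C j = y" "trg C j = s" "src C p = s" "trg C p = x"
      "src C q = s" "trg C q = y"
      using b by (auto simp: biproduct_def)
    interpret comm_group "HomGrp C s s" by (rule Hom_comm_group)
    have "padd C (j \<cdot> q) (i \<cdot> p) = padd C (i \<cdot> p) (j \<cdot> q)"
      using m_comm[of "j \<cdot> q" "i \<cdot> p"] b' by simp
    then show ?thesis using b unfolding biproduct_def by simp
  qed
  then show "s \<in> L \<Longrightarrow> x \<in> L \<and> y \<in> L"
    using L b unfolding thick_subcategory_def direct_summand_def by blast
  show "x \<in> L \<and> y \<in> L \<Longrightarrow> s \<in> L"
    using L b triangulated_biproduct unfolding thick_subcategory_def by blast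
qed

text \<open>For cones: \<open>g\<close> starts at a zero object, so the identity of the third object
  factors through \<open>h\<close>, which ends at a zero object. Preimages of this subcategory under
  tensoring yield the annihilators.\<close>

lemma triangulated_zero_objs: "triangulated_subcategory C {z. zero_obj C z}"
proof (rule triangulated_subcategoryI)
  show "{z. zero_obj C z} \<noteq> {}" using zero_exists by blast
  show "y \<in> {z. zero_obj C z}" if "x \<in> {z. zero_obj C z}" "isomorphic C x y" for x y
    using that zero_obj_isomorphic by blast
  have "zero_obj C x" if "zero_obj C (\<S> x)" for x
    using that susm_eq_zmorD[of "\<i> x" x x] by (simp add: zero_obj_iff sus_id)
  then show "\<S> x \<in> {z. zero_obj C z} \<longleftrightarrow> x \<in> {z. zero_obj C z}" for x
    using zero_obj_sus by blast
  show "trg C g \<in> {z. zero_obj C z}"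
    if tri: "(f, g, h) \<in> tri C" and z: "src C f \<in> {z. zero_obj C z}" "trg C f \<in> {z. zero_obj C z}"
    for f g h
  proof -
    note t = tri_types[OF tri]
    let ?z = "trg C g"
    have "g = zmor C (trg C f) ?z" using zmor_from_zero[of "trg C f" g] z t by simp
    then have "src C (\<i> ?z) = trg C g" "\<i> ?z \<cdot> g = zmor C (src C g) (trg C (\<i> ?z))"
      using t by simp_all
    then obtain \<theta> where \<theta>: "src C \<theta> = trg C h" "trg C \<theta> = trg C (\<i> ?z)" "\<i> ?z = \<theta> \<cdot> h"
      by (rule tri_weak_cokernel[OF tri_rot[OF tri]])
    have "h = zmor C ?z (trg C h)"
      using zmor_into_zero[of "trg C h" h] z t zero_obj_sus by simp
    then have "\<i> ?z = \<theta> \<cdot> zmor C ?z (trg C h)" using \<theta>(3) by simp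
    then show ?thesis using \<theta>(1,2) by (simp add: zero_obj_iff)
  qed
qed

section \<open>Intersections and chains of thick subcategories\<close>

lemma triangulated_Inter:
  assumes "\<And>L. L \<in> \<L> \<Longrightarrow> triangulated_subcategory C L"
  shows "triangulated_subcategory C (\<Inter>\<L>)"
proof (rule triangulated_subcategoryI)
  show "\<Inter>\<L> \<noteq> {}" using zero_exists triangulated_zero[OF assms] by blast
  show "y \<in> \<Inter>\<L>" if "x \<in> \<Inter>\<L>" "isomorphic C x y" for x y
    using that triangulated_isomorphic[OF assms] by blast
  show "\<S> x \<in> \<Inter>\<L> \<longleftrightarrow> x \<in> \<Inter>\<L>" for x
    using triangulated_sus_iff[OF assms] by blast
  show "trg C g \<in> \<Inter>\<L>" if "(f, g, h) \<in> tri C" "src C f \<in> \<Inter>\<L>" "trg C f \<in> \<Inter>\<L>" for f g h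
    using that triangulated_cone[OF assms] by blast
qed

lemma thick_Inter:
  assumes "\<And>L. L \<in> \<L> \<Longrightarrow> thick_subcategory C L"
  shows "thick_subcategory C (\<Inter>\<L>)"
  using assms triangulated_Inter[of \<L>] unfolding thick_subcategory_def by blast

text \<open>Only the cone condition involves two objects at once, and in a chain both lie in a
  common member. This is the upper bound for Zorn's lemma.\<close>

lemma thick_Union_chain:
  assumes "\<L> \<noteq> {}" "\<And>L. L \<in> \<L> \<Longrightarrow> thick_subcategory C L"
    and chain: "\<And>L M. \<lbrakk>L \<in> \<L>; M \<in> \<L>\<rbrakk> \<Longrightarrow> L \<subseteq> M \<or> M \<subseteq> L"
  shows "thick_subcategory C (\<Union>\<L>)"
proof -
  have tri: "triangulated_subcategory C L" if "L \<in> \<L>" for L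
    using assms(2)[OF that] unfolding thick_subcategory_def by blast
  have "triangulated_subcategory C (\<Union>\<L>)"
  proof (rule triangulated_subcategoryI)
    show "\<Union>\<L> \<noteq> {}" using zero_exists triangulated_zero[OF tri] assms(1) by blast
    show "y \<in> \<Union>\<L>" if "x \<in> \<Union>\<L>" "isomorphic C x y" for x y
      using that triangulated_isomorphic[OF tri] by blast
    show "\<S> x \<in> \<Union>\<L> \<longleftrightarrow> x \<in> \<Union>\<L>" for x
      using triangulated_sus_iff[OF tri] by blast
    show "trg C g \<in> \<Union>\<L>"
      if t: "(f, g, h) \<in> tri C" and fL: "src C f \<in> \<Union>\<L>" "trg C f \<in> \<Union>\<L>" for f g h
    proof -
      obtain L M where "L \<in> \<L>" "M \<in> \<L>" "src C f \<in> L" "trg C f \<in> M" using fL by blast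
      then obtain N where "N \<in> \<L>" "src C f \<in> N" "trg C f \<in> N" using chain by blast
      then show ?thesis using triangulated_cone[OF tri t] by blast
    qed
  qed
  then show ?thesis using assms(2) unfolding thick_subcategory_def by blast
qed

lemma thick_compacts: "thick_subcategory C (compacts \<kappa> C)"
  unfolding thick_subcategory_def
proof (intro conjI allI impI)
  show "triangulated_subcategory C (compacts \<kappa> C)"
  proof (rule triangulated_subcategoryI)
    show "compacts \<kappa> C \<noteq> {}"
      using zero_exists zero_obj_compact unfolding compacts_def by blast
    show "y \<in> compacts \<kappa> C" if "x \<in> compacts \<kappa> C" "isomorphic C x y" for x y
    proof -
      obtain f where f: "f \<in> Iso C x y" using \<open>isomorphic C x y\<close> unfolding isomorphic_def by blast
      show ?thesis
        by (rule IsoE[OF f]) (use that compact_retract[of \<kappa> x f _ y] in \<open>auto simp: compacts_def\<close>)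
    qed
    show "\<S> x \<in> compacts \<kappa> C \<longleftrightarrow> x \<in> compacts \<kappa> C" for x
      using compact_sus compact_desus unfolding compacts_def by blast
    show "trg C g \<in> compacts \<kappa> C"
      if "(f, g, h) \<in> tri C" "src C f \<in> compacts \<kappa> C" "trg C f \<in> compacts \<kappa> C" for f g h
      using that compact_cone unfolding compacts_def by blast
  qed
  show "x \<in> compacts \<kappa> C" if "s \<in> compacts \<kappa> C \<and> direct_summand C x s" for x s
    using that compact_retract unfolding compacts_def direct_summand_def biproduct_def in_Hom
    by blast
qed

end


section \<open>Tensor triangulated categories\<close>

context tensor_triangulated_category
begin

lemma src_ten [simp]: "src C (f \<star> g) = src C f \<odot> src C g"
  and trg_ten [simp]: "trg C (f \<star> g) = trg C f \<odot> trg C g"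
  using ten_Hom[of f "src C f" "trg C f" g "src C g" "trg C g"] by simp_all

lemma comp_ten:
  "\<lbrakk>trg C f = src C g; trg C f' = src C g'\<rbrakk> \<Longrightarrow> (g \<cdot> f) \<star> (g' \<cdot> f') = (g \<star> g') \<cdot> (f \<star> f')"
  using ten_comp[of f "src C f" "trg C f" g "trg C g" f' "src C f'" "trg C f'" g' "trg C g'"]
  by simp

lemma comp_ten_idm: "trg C f = src C g \<Longrightarrow> (g \<cdot> f) \<star> \<i> w = (g \<star> \<i> w) \<cdot> (f \<star> \<i> w)"
  using comp_ten[of f g "\<i> w" "\<i> w"] by simp

lemma zmor_ten [simp]: "zmor C x y \<star> \<i> w = zmor C (x \<odot> w) (y \<odot> w)"
  using ten_add[of "zmor C x y" x y "zmor C x y" w] by (intro padd_idem_imp_zmor) simp_all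

lemma src_asc [simp]: "src C (asc C x y z) = (x \<odot> y) \<odot> z"
  and trg_asc [simp]: "trg C (asc C x y z) = x \<odot> (y \<odot> z)"
  using asc_Iso[of x y z] by (auto simp: Iso_def)

lemma src_run [simp]: "src C (run C x) = x \<odot> \<I>" and trg_run [simp]: "trg C (run C x) = x"
  using run_Iso[of x] by (auto simp: Iso_def)

lemma src_lun [simp]: "src C (lun C x) = \<I> \<odot> x" and trg_lun [simp]: "trg C (lun C x) = x"
  using lun_Iso[of x] by (auto simp: Iso_def)

lemma Iso_ten:
  assumes "f \<in> Iso C x y" "g \<in> Iso C x' y'"
  shows "f \<star> g \<in> Iso C (x \<odot> x') (y \<odot> y')"
proof -
  obtain f' where f: "src C f = x" "trg C f = y" "src C f' = y" "trg C f' = x"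
    "f' \<cdot> f = \<i> x" "f \<cdot> f' = \<i> y"
    using assms(1) by (rule IsoE)
  obtain g' where g: "src C g = x'" "trg C g = y'" "src C g' = y'" "trg C g' = x'"
    "g' \<cdot> g = \<i> x'" "g \<cdot> g' = \<i> y'"
    using assms(2) by (rule IsoE)
  show ?thesis
    by (rule IsoI[where g="f' \<star> g'"]) (use f g in \<open>simp_all add: ten_id flip: comp_ten\<close>)
qed

lemma isomorphic_ten: "isomorphic C x y \<Longrightarrow> isomorphic C (x \<odot> w) (y \<odot> w)"
  unfolding isomorphic_def using Iso_ten[OF _ Iso_idm] by blast

lemma isomorphic_brd: "isomorphic C (x \<odot> y) (y \<odot> x)"
  unfolding isomorphic_def using brd_Iso by blast

lemma isomorphic_asc: "isomorphic C ((x \<odot> y) \<odot> z) (x \<odot> (y \<odot> z))"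
  unfolding isomorphic_def using asc_Iso by blast

lemma isomorphic_ten_swap: "isomorphic C ((x \<odot> y) \<odot> z) ((x \<odot> z) \<odot> y)"
proof -
  have "isomorphic C (x \<odot> (y \<odot> z)) (x \<odot> (z \<odot> y))"
    using isomorphic_trans[OF isomorphic_brd isomorphic_trans[OF isomorphic_ten[OF isomorphic_brd] isomorphic_brd]] .
  then show ?thesis
    using isomorphic_trans[OF isomorphic_asc isomorphic_trans[OF _ isomorphic_sym[OF isomorphic_asc]]]
    by blast
qed

lemma zero_obj_ten: "zero_obj C x \<Longrightarrow> zero_obj C (x \<odot> w)"
  unfolding zero_obj_iff by (metis ten_id zmor_ten)

lemma zero_obj_ten_commute: "zero_obj C (x \<odot> y) \<longleftrightarrow> zero_obj C (y \<odot> x)"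
  using zero_obj_isomorphic isomorphic_brd by blast

text \<open>A preimage under the exact functor \<open>- \<odot> w\<close>. It serves both
  annihilators (preimages of the zero objects) and ideal quotients (preimages of a tensor
  ideal).\<close>

lemma triangulated_ten:
  assumes L: "triangulated_subcategory C L"
  shows "triangulated_subcategory C {x. x \<odot> w \<in> L}"
proof (rule triangulated_subcategoryI)
  show "{x. x \<odot> w \<in> L} \<noteq> {}"
    using zero_exists zero_obj_ten triangulated_zero[OF L] by blast
  show "y \<in> {x. x \<odot> w \<in> L}" if "x \<in> {x. x \<odot> w \<in> L}" "isomorphic C x y" for x y
    using that triangulated_isomorphic[OF L _ isomorphic_ten] by blast
  have "isomorphic C (\<S> x \<odot> w) (\<S> (x \<odot> w))" for x
    unfolding isomorphic_def using sten_Iso by blast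
  then have "\<S> x \<odot> w \<in> L \<longleftrightarrow> \<S> (x \<odot> w) \<in> L" for x
    using triangulated_isomorphic[OF L] isomorphic_sym by blast
  then show "\<S> x \<in> {x. x \<odot> w \<in> L} \<longleftrightarrow> x \<in> {x. x \<odot> w \<in> L}" for x
    using triangulated_sus_iff[OF L] by blast
  show "trg C g \<in> {x. x \<odot> w \<in> L}"
    if tri: "(f, g, h) \<in> tri C" and fL: "src C f \<in> {x. x \<odot> w \<in> L}" "trg C f \<in> {x. x \<odot> w \<in> L}"
    for f g h
  proof -
    have "(f \<star> \<i> w, g \<star> \<i> w, sten C (src C f) w \<cdot> (h \<star> \<i> w)) \<in> tri C"
      by (rule ten_exact[OF tri]) (use tri_types[OF tri] in auto)
    from triangulated_cone[OF L this] show ?thesis using fL by simp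
  qed
qed

lemma biproduct_ten:
  assumes "biproduct C x y s i j p q"
  shows "biproduct C (x \<odot> w) (y \<odot> w) (s \<odot> w) (i \<star> \<i> w) (j \<star> \<i> w) (p \<star> \<i> w) (q \<star> \<i> w)"
proof -
  have b: "src C i = x" "trg C i = s" "src C j = y" "trg C j = s" "src C p = s" "trg C p = x"
    "src C q = s" "trg C q = y" "p \<cdot> i = \<i> x" "q \<cdot> j = \<i> y" "p \<cdot> j = zmor C y x" "q \<cdot> i = zmor C x y"
    "padd C (i \<cdot> p) (j \<cdot> q) = \<i> s"
    using assms by (auto simp: biproduct_def)
  have "padd C ((i \<cdot> p) \<star> \<i> w) ((j \<cdot> q) \<star> \<i> w) = \<i> (s \<odot> w)"
    using ten_add[of "i \<cdot> p" s s "j \<cdot> q" w] b by (simp add: ten_id)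
  then show ?thesis
    unfolding biproduct_def using b by (simp add: ten_id flip: comp_ten_idm)
qed

lemma thick_ten:
  assumes "thick_subcategory C L"
  shows "thick_subcategory C {x. x \<odot> w \<in> L}"
  unfolding thick_subcategory_def
proof (intro conjI allI impI)
  show "triangulated_subcategory C {x. x \<odot> w \<in> L}"
    using assms triangulated_ten unfolding thick_subcategory_def by blast
  show "x \<in> {x. x \<odot> w \<in> L}" if "s \<in> {x. x \<odot> w \<in> L} \<and> direct_summand C x s" for x s
    using that biproduct_ten assms unfolding thick_subcategory_def direct_summand_def by blast
qed


subsection \<open>Tensor products and coproducts\<close>

lemma internal_hom:
  obtains h ev where "src C ev = h \<odot> y" "trg C ev = z"
    "\<And>x f. \<lbrakk>src C f = x \<odot> y; trg C f = z\<rbrakk> \<Longrightarrow> \<exists>g. src C g = x \<and> trg C g = h \<and> ev \<cdot> (g \<star> \<i> y) = f"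
    "\<And>g g'. \<lbrakk>src C g = src C g'; trg C g = h; trg C g' = h; ev \<cdot> (g \<star> \<i> y) = ev \<cdot> (g' \<star> \<i> y)\<rbrakk>
      \<Longrightarrow> g = g'"
proof -
  obtain h ev where ev: "ev \<in> Hom C (h \<odot> y) z"
    "\<And>x f. f \<in> Hom C (x \<odot> y) z \<Longrightarrow> \<exists>!g. g \<in> Hom C x h \<and> ev \<cdot> (g \<star> \<i> y) = f"
    using closed[of y z] by blast
  show thesis
  proof (rule that[of ev h])
    show "\<exists>g. src C g = x \<and> trg C g = h \<and> ev \<cdot> (g \<star> \<i> y) = f"
      if "src C f = x \<odot> y" "trg C f = z" for x f
      using ev(2)[of f x] that by auto
    show "g = g'" if "src C g = src C g'" "trg C g = h" "trg C g' = h"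
      "ev \<cdot> (g \<star> \<i> y) = ev \<cdot> (g' \<star> \<i> y)" for g g'
    proof -
      have "ev \<cdot> (g' \<star> \<i> y) \<in> Hom C (src C g' \<odot> y) z" using ev(1) that by simp
      from ev(2)[OF this]
      have "\<exists>!k. k \<in> Hom C (src C g') h \<and> ev \<cdot> (k \<star> \<i> y) = ev \<cdot> (g' \<star> \<i> y)" .
      moreover have "g \<in> Hom C (src C g') h \<and> ev \<cdot> (g \<star> \<i> y) = ev \<cdot> (g' \<star> \<i> y)"
        "g' \<in> Hom C (src C g') h \<and> ev \<cdot> (g' \<star> \<i> y) = ev \<cdot> (g' \<star> \<i> y)"
        using that by simp_all
      ultimately show ?thesis by blast
    qed
  qed (use ev(1) in auto)
qed

text \<open>Tensoring with \<open>w\<close> is a left adjoint: a cocone on the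
  \<open>y i \<odot> w\<close> transposes to one on the \<open>y i\<close>, where the coproduct
  property applies.\<close>

lemma coproduct_ten:
  assumes c: "coproduct C I y c j"
  shows "coproduct C I (\<lambda>i. y i \<odot> w) (c \<odot> w) (\<lambda>i. j i \<star> \<i> w)"
proof (rule coproductI)
  note j = coproductD[OF c]
  show "\<exists>h. src C h = c \<odot> w \<and> trg C h = z \<and> (\<forall>i\<in>I. h \<cdot> (j i \<star> \<i> w) = f i)"
    if f: "\<And>i. i \<in> I \<Longrightarrow> src C (f i) = y i \<odot> w" "\<And>i. i \<in> I \<Longrightarrow> trg C (f i) = z" for z f
  proof -
    obtain h ev where ev: "src C ev = h \<odot> w" "trg C ev = z"
      and ex: "\<And>x f. \<lbrakk>src C f = x \<odot> w; trg C f = z\<rbrakk>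
        \<Longrightarrow> \<exists>g. src C g = x \<and> trg C g = h \<and> ev \<cdot> (g \<star> \<i> w) = f"
      by (rule internal_hom) blast
    have "\<exists>g. \<forall>i\<in>I. src C (g i) = y i \<and> trg C (g i) = h \<and> ev \<cdot> (g i \<star> \<i> w) = f i"
      by (intro bchoice) (use ex f in blast)
    then obtain g where g: "\<And>i. i \<in> I \<Longrightarrow> src C (g i) = y i" "\<And>i. i \<in> I \<Longrightarrow> trg C (g i) = h"
      "\<And>i. i \<in> I \<Longrightarrow> ev \<cdot> (g i \<star> \<i> w) = f i"
      by blast
    obtain k where k: "src C k = c" "trg C k = h" "\<And>i. i \<in> I \<Longrightarrow> k \<cdot> j i = g i"
      by (rule coproduct_ex[OF c, of g h]) (use g in auto)
    have "(ev \<cdot> (k \<star> \<i> w)) \<cdot> (j i \<star> \<i> w) = f i" if i: "i \<in> I" for i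
    proof -
      have "(ev \<cdot> (k \<star> \<i> w)) \<cdot> (j i \<star> \<i> w) = ev \<cdot> ((k \<cdot> j i) \<star> \<i> w)"
        using ev k(1,2) j[OF i] by (simp add: comp_ten_idm)
      then show ?thesis using k(3) g(3) i by simp
    qed
    then show ?thesis using ev k(1,2) by (intro exI[of _ "ev \<cdot> (k \<star> \<i> w)"]) simp
  qed
  show "a = b" if ab: "src C a = c \<odot> w" "src C b = c \<odot> w" "trg C a = trg C b"
    "\<And>i. i \<in> I \<Longrightarrow> a \<cdot> (j i \<star> \<i> w) = b \<cdot> (j i \<star> \<i> w)" for a b
  proof -
    obtain h ev where ev: "src C ev = h \<odot> w" "trg C ev = trg C b"
      and ex: "\<And>x f. \<lbrakk>src C f = x \<odot> w; trg C f = trg C b\<rbrakk>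
        \<Longrightarrow> \<exists>g. src C g = x \<and> trg C g = h \<and> ev \<cdot> (g \<star> \<i> w) = f"
      and uniq: "\<And>g g'. \<lbrakk>src C g = src C g'; trg C g = h; trg C g' = h;
        ev \<cdot> (g \<star> \<i> w) = ev \<cdot> (g' \<star> \<i> w)\<rbrakk> \<Longrightarrow> g = g'"
      by (rule internal_hom) blast
    obtain g where g: "src C g = c" "trg C g = h" "ev \<cdot> (g \<star> \<i> w) = a"
      using ex[OF ab(1,3)] by blast
    obtain g' where g': "src C g' = c" "trg C g' = h" "ev \<cdot> (g' \<star> \<i> w) = b"
      using ex[OF ab(2) refl] by blast
    have "g \<cdot> j i = g' \<cdot> j i" if i: "i \<in> I" for i
    proof (rule uniq)
      have "(ev \<cdot> (g \<star> \<i> w)) \<cdot> (j i \<star> \<i> w) = (ev \<cdot> (g' \<star> \<i> w)) \<cdot> (j i \<star> \<i> w)"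
        using ab(4)[OF i] g(3) g'(3) by simp
      then show "ev \<cdot> ((g \<cdot> j i) \<star> \<i> w) = ev \<cdot> ((g' \<cdot> j i) \<star> \<i> w)"
        using g(1,2) g'(1,2) j[OF i] ev by (simp add: comp_ten_idm)
    qed (use g(1,2) g'(1,2) j[OF i] in simp_all)
    then have "g = g'"
      by (intro coproduct_eqI[OF c, of g g']) (use g(1,2) g'(1,2) in simp_all)
    then show ?thesis using g(3) g'(3) by simp
  qed
qed (use coproductD[OF c] in auto)

section \<open>Annihilators as localizing ideals\<close>

lemma coproduct_zero:
  assumes c: "coproduct C I y c j" and "\<And>i. i \<in> I \<Longrightarrow> zero_obj C (y i)"
  shows "zero_obj C c"
  unfolding zero_obj_iff
proof (rule coproduct_eqI[OF c])
  fix i assume i: "i \<in> I"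
  note j = coproductD[OF c i]
  show "\<i> c \<cdot> j i = zmor C c c \<cdot> j i"
    using zmor_from_zero[OF assms(2)[OF i], of "j i"] j by simp
qed simp_all

text \<open>The extreme cases give the two reference ideals: \<open>annihilator {}\<close> consists
  of all objects, and \<open>annihilator UNIV\<close> of the zero objects, as the unit is among the
  test objects.\<close>

definition annihilator :: "'o set \<Rightarrow> 'o set" where
  "annihilator K = {t. \<forall>c\<in>K. zero_obj C (t \<odot> c)}"

text \<open>It is an intersection of kernels of the exact, coproduct-preserving functors
  \<open>- \<odot> c\<close>; commuting the last two factors of (s \<otimes> t) \<otimes> c gives
  the ideal property.\<close>

lemma localizing_ideal_annihilator:
  fixes \<kappa> :: "'u rel"
  shows "localizing_ideal \<kappa> C (annihilator K)"
  unfolding localizing_ideal_def localizing_subcategory_def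
proof (intro conjI allI impI ballI)
  let ?L = "(\<lambda>c. {t. t \<odot> c \<in> {z. zero_obj C z}}) ` K"
  have "triangulated_subcategory C (\<Inter>?L)"
    by (rule triangulated_Inter) (use triangulated_ten[OF triangulated_zero_objs] in blast)
  moreover have "annihilator K = \<Inter>?L" by (auto simp: annihilator_def)
  ultimately show "triangulated_subcategory C (annihilator K)" by simp
  show "c \<in> annihilator K"
    if "small \<kappa> I \<and> (\<forall>i\<in>I. x i \<in> annihilator K) \<and> coproduct C I x c j" for I x c j
    using that coproduct_zero[OF coproduct_ten] unfolding annihilator_def by blast
  show "s \<odot> t \<in> annihilator K" if "s \<in> annihilator K" for s t
    using that zero_obj_isomorphic[OF isomorphic_ten_swap] zero_obj_ten
    unfolding annihilator_def by blast
qed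


subsection \<open>Tensor products of compact objects\<close>

text \<open>
  The map \<open>a \<mapsto> (a \<otimes> d) \<circ> u\<close> is the adjunction \<open>Hom (b \<otimes> x, c) \<rightarrow> Hom (b, c \<otimes> d)\<close>.
  For its injectivity it suffices that going back amounts to composition with some isomorphism,
  which avoids the coherence theorem for the unit constraints.
\<close>

lemma rigid_ten_faithful:
  assumes "rigid_obj C x"
  obtains d where "\<And>b. \<exists>u. src C u = b \<and> trg C u = (b \<odot> x) \<odot> d \<and>
    (\<forall>a. src C a = b \<odot> x \<longrightarrow> (a \<star> \<i> d) \<cdot> u = zmor C b (trg C a \<odot> d)
      \<longrightarrow> a = zmor C (b \<odot> x) (trg C a))"
proof -
  obtain d ev coev where ev: "src C ev = d \<odot> x" "trg C ev = \<I>"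
    and coev: "src C coev = \<I>" "trg C coev = x \<odot> d"
    and zigzag: "run C x \<cdot> ((\<i> x \<star> ev) \<cdot> (asc C x d x \<cdot> (coev \<star> \<i> x))) = lun C x"
    using assms unfolding rigid_obj_def by auto
  \<comment> \<open>The zigzag with its final unit isomorphism left off; the triangle identity turns
    it into a composite of unit isomorphisms.\<close>
  define n where "n = (\<i> x \<star> ev) \<cdot> (asc C x d x \<cdot> (coev \<star> \<i> x))"
  have n: "src C n = \<I> \<odot> x" "trg C n = x \<odot> \<I>" using ev coev by (simp_all add: n_def)
  obtain r where r: "src C r = x" "trg C r = x \<odot> \<I>" "r \<cdot> run C x = \<i> (x \<odot> \<I>)"
    "r \<in> Iso C x (x \<odot> \<I>)"
    using run_Iso[of x] by (rule IsoE)
  have "n = r \<cdot> (run C x \<cdot> n)" using r n by (simp add: comp_cancel[OF r(3)])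
  also have "\<dots> = r \<cdot> lun C x" using zigzag by (simp add: n_def)
  finally have n_Iso: "n \<in> Iso C (\<I> \<odot> x) (x \<odot> \<I>)" using Iso_comp[OF lun_Iso r(4)] by simp
  show thesis
  proof (rule that)
    fix b
    obtain ai where ai: "src C ai = b \<odot> (x \<odot> d)" "trg C ai = (b \<odot> x) \<odot> d"
      "asc C b x d \<cdot> ai = \<i> (b \<odot> (x \<odot> d))"
      using asc_Iso[of b x d] by (rule IsoE)
    obtain ri where ri: "src C ri = b" "trg C ri = b \<odot> \<I>" "ri \<in> Iso C b (b \<odot> \<I>)"
      using run_Iso[of b] by (rule IsoE)
    obtain Ai where Ai: "src C Ai = b \<odot> (x \<odot> \<I>)" "trg C Ai = (b \<odot> x) \<odot> \<I>"
      "Ai \<cdot> asc C b x \<I> = \<i> ((b \<odot> x) \<odot> \<I>)" "Ai \<in> Iso C (b \<odot> (x \<odot> \<I>)) ((b \<odot> x) \<odot> \<I>)"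
      using asc_Iso[of b x "\<I>"] by (rule IsoE)
    \<comment> \<open>The unit of the adjunction at \<open>b\<close>: coevaluation inserted to the
      right of \<open>b\<close>, then reassociated.\<close>
    define u where "u = ai \<cdot> ((\<i> b \<star> coev) \<cdot> ri)"
    have u: "src C u = b" "trg C u = (b \<odot> x) \<odot> d"
      using ai ri coev by (simp_all add: u_def)
    \<comment> \<open>The round trip: apply the unit, then evaluate the new factor \<open>d\<close>
      against \<open>x\<close>. It is an endomorphism of \<open>b \<odot> x\<close> up to a
      remaining unit factor on the right.\<close>
    define e0 where "e0 = (\<i> (b \<odot> x) \<star> ev) \<cdot> (asc C (b \<odot> x) d x \<cdot> (u \<star> \<i> x))"
    have e0: "src C e0 = b \<odot> x" "trg C e0 = (b \<odot> x) \<odot> \<I>"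
      using u ev by (simp_all add: e0_def)
    have asc_u: "asc C b x d \<cdot> u = (\<i> b \<star> coev) \<cdot> ri"
      using ai ri coev by (simp add: u_def comp_cancel[OF ai(3)])
    have "asc C b x \<I> \<cdot> e0
        = (asc C b x \<I> \<cdot> ((\<i> b \<star> \<i> x) \<star> ev)) \<cdot> (asc C (b \<odot> x) d x \<cdot> (u \<star> \<i> x))"
      using u ev by (simp add: e0_def ten_id)
    also have "asc C b x \<I> \<cdot> ((\<i> b \<star> \<i> x) \<star> ev) = (\<i> b \<star> (\<i> x \<star> ev)) \<cdot> asc C b x (d \<odot> x)"
      by (rule asc_natural) (use ev in auto)
    also have "((\<i> b \<star> (\<i> x \<star> ev)) \<cdot> asc C b x (d \<odot> x)) \<cdot> (asc C (b \<odot> x) d x \<cdot> (u \<star> \<i> x))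
        = (\<i> b \<star> (\<i> x \<star> ev)) \<cdot> ((asc C b x (d \<odot> x) \<cdot> asc C (b \<odot> x) d x) \<cdot> (u \<star> \<i> x))"
      using u ev by simp
    also have "asc C b x (d \<odot> x) \<cdot> asc C (b \<odot> x) d x
        = (\<i> b \<star> asc C x d x) \<cdot> (asc C b (x \<odot> d) x \<cdot> (asc C b x d \<star> \<i> x))"
      by (rule pentagon)
    also have "((\<i> b \<star> asc C x d x) \<cdot> (asc C b (x \<odot> d) x \<cdot> (asc C b x d \<star> \<i> x))) \<cdot> (u \<star> \<i> x)
        = (\<i> b \<star> asc C x d x) \<cdot> (asc C b (x \<odot> d) x \<cdot> ((asc C b x d \<cdot> u) \<star> \<i> x))"
      using u by (simp add: comp_ten_idm)
    also have "(asc C b x d \<cdot> u) \<star> \<i> x = ((\<i> b \<star> coev) \<star> \<i> x) \<cdot> (ri \<star> \<i> x)"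
      unfolding asc_u using coev ri by (simp add: comp_ten_idm)
    also have "asc C b (x \<odot> d) x \<cdot> (((\<i> b \<star> coev) \<star> \<i> x) \<cdot> (ri \<star> \<i> x))
        = (asc C b (x \<odot> d) x \<cdot> ((\<i> b \<star> coev) \<star> \<i> x)) \<cdot> (ri \<star> \<i> x)"
      using coev ri by simp
    also have "asc C b (x \<odot> d) x \<cdot> ((\<i> b \<star> coev) \<star> \<i> x) = (\<i> b \<star> (coev \<star> \<i> x)) \<cdot> asc C b \<I> x"
      by (rule asc_natural) (use coev in auto)
    also have "(\<i> b \<star> (\<i> x \<star> ev)) \<cdot> ((\<i> b \<star> asc C x d x) \<cdot>
          (((\<i> b \<star> (coev \<star> \<i> x)) \<cdot> asc C b \<I> x) \<cdot> (ri \<star> \<i> x)))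
        = ((\<i> b \<star> (\<i> x \<star> ev)) \<cdot> ((\<i> b \<star> asc C x d x) \<cdot> (\<i> b \<star> (coev \<star> \<i> x))))
          \<cdot> (asc C b \<I> x \<cdot> (ri \<star> \<i> x))"
      using coev ri ev by simp
    also have "(\<i> b \<star> (\<i> x \<star> ev)) \<cdot> ((\<i> b \<star> asc C x d x) \<cdot> (\<i> b \<star> (coev \<star> \<i> x))) = \<i> b \<star> n"
      using coev ev by (simp add: n_def flip: comp_ten)
    finally have "asc C b x \<I> \<cdot> e0 = (\<i> b \<star> n) \<cdot> (asc C b \<I> x \<cdot> (ri \<star> \<i> x))" .
    moreover have "(\<i> b \<star> n) \<cdot> (asc C b \<I> x \<cdot> (ri \<star> \<i> x)) \<in> Iso C (b \<odot> x) (b \<odot> (x \<odot> \<I>))"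
      using Iso_comp[OF Iso_comp[OF Iso_ten[OF ri(3) Iso_idm] asc_Iso] Iso_ten[OF Iso_idm n_Iso]] .
    ultimately have "Ai \<cdot> (asc C b x \<I> \<cdot> e0) \<in> Iso C (b \<odot> x) ((b \<odot> x) \<odot> \<I>)"
      using Iso_comp[OF _ Ai(4)] by simp
    moreover have "Ai \<cdot> (asc C b x \<I> \<cdot> e0) = e0"
      using Ai(1,2) e0 by (simp add: comp_cancel[OF Ai(3)])
    ultimately have e: "run C (b \<odot> x) \<cdot> e0 \<in> Iso C (b \<odot> x) (b \<odot> x)"
      using Iso_comp[OF _ run_Iso] by simp
    \<comment> \<open>By naturality, \<open>a\<close> after the round trip contains
      \<open>(a \<star> \<i> d) \<cdot> u\<close> as a factor and so vanishes; the round trip is an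
      isomorphism and cancels.\<close>
    have "a = zmor C (b \<odot> x) (trg C a)"
      if a: "src C a = b \<odot> x" "(a \<star> \<i> d) \<cdot> u = zmor C b (trg C a \<odot> d)" for a
    proof -
      let ?c = "trg C a"
      have "a \<cdot> (run C (b \<odot> x) \<cdot> e0) = (a \<cdot> run C (b \<odot> x)) \<cdot> e0" using a(1) e0 by simp
      also have "a \<cdot> run C (b \<odot> x) = run C ?c \<cdot> (a \<star> \<i> \<I>)"
        by (rule run_natural[symmetric]) (use a(1) in simp)
      also have "(run C ?c \<cdot> (a \<star> \<i> \<I>)) \<cdot> e0
          = run C ?c \<cdot> (((a \<star> \<i> \<I>) \<cdot> (\<i> (b \<odot> x) \<star> ev)) \<cdot> (asc C (b \<odot> x) d x \<cdot> (u \<star> \<i> x)))"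
        using a(1) u ev by (simp add: e0_def)
      also have "(a \<star> \<i> \<I>) \<cdot> (\<i> (b \<odot> x) \<star> ev) = (\<i> ?c \<star> ev) \<cdot> (a \<star> (\<i> d \<star> \<i> x))"
        using a(1) ev by (simp add: ten_id flip: comp_ten)
      also have "((\<i> ?c \<star> ev) \<cdot> (a \<star> (\<i> d \<star> \<i> x))) \<cdot> (asc C (b \<odot> x) d x \<cdot> (u \<star> \<i> x))
          = (\<i> ?c \<star> ev) \<cdot> (((a \<star> (\<i> d \<star> \<i> x)) \<cdot> asc C (b \<odot> x) d x) \<cdot> (u \<star> \<i> x))"
        using a(1) ev u by simp
      also have "(a \<star> (\<i> d \<star> \<i> x)) \<cdot> asc C (b \<odot> x) d x = asc C ?c d x \<cdot> ((a \<star> \<i> d) \<star> \<i> x)"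
        by (rule asc_natural[symmetric]) (use a(1) in simp_all)
      also have "(asc C ?c d x \<cdot> ((a \<star> \<i> d) \<star> \<i> x)) \<cdot> (u \<star> \<i> x)
          = asc C ?c d x \<cdot> (((a \<star> \<i> d) \<cdot> u) \<star> \<i> x)"
        using a(1) u by (simp add: comp_ten_idm)
      also have "run C ?c \<cdot> ((\<i> ?c \<star> ev) \<cdot> (asc C ?c d x \<cdot> (((a \<star> \<i> d) \<cdot> u) \<star> \<i> x)))
          = zmor C (b \<odot> x) ?c"
        unfolding a(2) using ev by simp
      finally show ?thesis using Iso_cancel_right[OF e _ a(1)] by simp
    qed
    then show "\<exists>u. src C u = b \<and> trg C u = (b \<odot> x) \<odot> d \<and>
      (\<forall>a. src C a = b \<odot> x \<longrightarrow> (a \<star> \<i> d) \<cdot> u = zmor C b (trg C a \<odot> d)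
        \<longrightarrow> a = zmor C (b \<odot> x) (trg C a))"
      using u by blast
  qed
qed

text \<open>The transpose of \<open>f\<close> is an arrow from the compact \<open>b\<close> into
  \<open>c \<odot> d\<close>, again a coproduct. Its killer is of the form
  \<open>l \<star> \<i> d\<close>, so faithfulness of transposition shows that \<open>l\<close>
  kills \<open>f\<close>.\<close>

lemma compact_ten_rigid:
  fixes \<kappa> :: "'u rel"
  assumes "compact_obj \<kappa> C b" "rigid_obj C x"
  shows "compact_obj \<kappa> C (b \<odot> x)"
  unfolding compact_iff finitely_factoring_def
proof (intro allI impI, elim conjE)
  fix I :: "'u set" and y c j f
  assume I: "small \<kappa> I" and c: "coproduct C I y c j" and f: "src C f = b \<odot> x" "trg C f = c"
  obtain d u where u: "src C u = b" "trg C u = (b \<odot> x) \<odot> d"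
    and faithful: "\<And>a. \<lbrakk>src C a = b \<odot> x; (a \<star> \<i> d) \<cdot> u = zmor C b (trg C a \<odot> d)\<rbrakk>
      \<Longrightarrow> a = zmor C (b \<odot> x) (trg C a)"
    using rigid_ten_faithful[OF assms(2)] by metis
  have "src C ((f \<star> \<i> d) \<cdot> u) = b" "trg C ((f \<star> \<i> d) \<cdot> u) = c \<odot> d" using u f by auto
  then obtain F k where k: "finite F" "kills I (c \<odot> d) (\<lambda>i. j i \<star> \<i> d) F k"
      "k \<cdot> ((f \<star> \<i> d) \<cdot> u) = zmor C b (c \<odot> d)"
    by (rule finitely_factoringD[OF assms(1)[unfolded compact_iff] I coproduct_ten[OF c]])
  obtain l where l: "kills I c j F l" by (rule kills_ex[OF c])
  then have l': "src C l = c" "trg C l = c" by (auto simp: kills_def)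
  have "(l \<star> \<i> d) \<cdot> (j i \<star> \<i> d) = (if i \<in> F then zmor C (src C (j i) \<odot> d) (c \<odot> d) else j i \<star> \<i> d)"
    if i: "i \<in> I" for i
  proof -
    have "l \<cdot> j i = (if i \<in> F then zmor C (src C (j i)) c else j i)"
      using l i by (simp add: kills_def)
    then show ?thesis
      using l' coproductD[OF c i] by (simp flip: comp_ten_idm)
  qed
  then have "kills I (c \<odot> d) (\<lambda>i. j i \<star> \<i> d) F (l \<star> \<i> d)"
    using l' by (simp add: kills_def)
  then have "k = l \<star> \<i> d" by (rule kills_unique[OF coproduct_ten[OF c] k(2)])
  then have "((l \<cdot> f) \<star> \<i> d) \<cdot> u = zmor C b (c \<odot> d)"
    using k(3) u f l' by (simp add: comp_ten_idm)
  then have "l \<cdot> f = zmor C (b \<odot> x) c"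
    using faithful[of "l \<cdot> f"] f l' by simp
  then show "\<exists>F k. finite F \<and> kills I c j F k \<and> k \<cdot> f = zmor C (b \<odot> x) c"
    using k(1) l by blast
qed

end


section \<open>The localizing topology\<close>

lemma thomason_empty: "thomason X {}"
  unfolding thomason_def by (rule exI[of _ "{}"]) simp

lemma thomason_topspace: "thomason X (topspace X)"
  unfolding thomason_def by (rule exI[of _ "{topspace X}"]) simp

lemma thomason_subset: "thomason X Y \<Longrightarrow> Y \<subseteq> topspace X"
  unfolding thomason_def by (auto dest: closedin_subset)

lemma thomason_Un:
  assumes "thomason X Y" "thomason X Z"
  shows "thomason X (Y \<union> Z)"
proof -
  obtain \<Y> \<Z> where "Y = \<Union>\<Y>" "\<forall>A\<in>\<Y>. closedin X A \<and> compactin X (topspace X - A)"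
    "Z = \<Union>\<Z>" "\<forall>A\<in>\<Z>. closedin X A \<and> compactin X (topspace X - A)"
    using assms unfolding thomason_def by blast
  then show ?thesis unfolding thomason_def by (intro exI[of _ "\<Y> \<union> \<Z>"]) auto
qed

lemma thomason_Int:
  assumes "thomason X Y" "thomason X Z"
  shows "thomason X (Y \<inter> Z)"
proof -
  obtain \<Y> \<Z> where Y: "Y = \<Union>\<Y>" "\<And>A. A \<in> \<Y> \<Longrightarrow> closedin X A \<and> compactin X (topspace X - A)"
    and Z: "Z = \<Union>\<Z>" "\<And>A. A \<in> \<Z> \<Longrightarrow> closedin X A \<and> compactin X (topspace X - A)"
    using assms unfolding thomason_def by blast
  let ?W = "{A \<inter> B | A B. A \<in> \<Y> \<and> B \<in> \<Z>}"
  have "closedin X (A \<inter> B) \<and> compactin X (topspace X - (A \<inter> B))" if "A \<in> \<Y>" "B \<in> \<Z>" for A B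
    using Y(2)[OF that(1)] Z(2)[OF that(2)] by (auto simp: Diff_Int intro: compactin_Un)
  moreover have "Y \<inter> Z = \<Union>?W" using Y(1) Z(1) by auto
  ultimately show ?thesis unfolding thomason_def by (intro exI[of _ ?W]) auto
qed

lemma weakly_visible_thomason: "thomason X U \<Longrightarrow> weakly_visible X U"
  unfolding weakly_visible_def
  using thomason_empty[of X] thomason_subset[of X U] by (intro exI[of _ U] exI[of _ "{}"]) auto

lemma weakly_visible_co_thomason: "thomason X V \<Longrightarrow> weakly_visible X (topspace X - V)"
  unfolding weakly_visible_def
  using thomason_topspace[of X] by (intro exI[of _ "topspace X"] exI[of _ V]) auto

lemma weakly_visible_Int:
  assumes "weakly_visible X W" "weakly_visible X W'"
  shows "weakly_visible X (W \<inter> W')"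
proof -
  obtain U V U' V' where "thomason X U" "thomason X V" "W = U \<inter> (topspace X - V)"
    "thomason X U'" "thomason X V'" "W' = U' \<inter> (topspace X - V')"
    using assms unfolding weakly_visible_def by blast
  then show ?thesis unfolding weakly_visible_def
    by (intro exI[of _ "U \<inter> U'"] exI[of _ "V \<union> V'"]) (auto simp: thomason_Int thomason_Un)
qed

lemma openin_localizing_topology:
  "openin (localizing_topology X) = arbitrary union_of weakly_visible X"
  unfolding localizing_topology_def
  by (intro topology_inverse' istopology_base weakly_visible_Int)

lemma openin_localizing_weakly_visible:
  "weakly_visible X W \<Longrightarrow> openin (localizing_topology X) W"
  unfolding openin_localizing_topology by (simp add: arbitrary_union_of_inc)

lemma topspace_localizing_topology [simp]: "topspace (localizing_topology X) = topspace X"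
proof
  show "topspace X \<subseteq> topspace (localizing_topology X)"
    using openin_localizing_weakly_visible[OF weakly_visible_thomason[OF thomason_topspace]]
    by (rule openin_subset)
  have "openin (localizing_topology X) (topspace (localizing_topology X))" by simp
  then obtain \<W> where "\<And>W. W \<in> \<W> \<Longrightarrow> weakly_visible X W" "\<Union>\<W> = topspace (localizing_topology X)"
    unfolding openin_localizing_topology union_of_def by auto
  then show "topspace (localizing_topology X) \<subseteq> topspace X"
    unfolding weakly_visible_def by blast
qed

text \<open>A union of basic sets equal to one point has that point itself as a member.\<close>

lemma weakly_visible_singleton:
  assumes "openin (localizing_topology X) {x}"
  shows "weakly_visible X {x}"
proof -
  obtain \<W> where W: "\<And>W. W \<in> \<W> \<Longrightarrow> weakly_visible X W" "\<Union>\<W> = {x}"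
    using assms unfolding openin_localizing_topology union_of_def by auto
  then obtain W where "W \<in> \<W>" "x \<in> W" by blast
  moreover from this W(2) have "W = {x}" by blast
  ultimately show ?thesis using W(1) by blast
qed

lemma closedin_localizing_singleton:
  assumes "x \<in> topspace X"
    and "\<And>y. \<lbrakk>y \<in> topspace X; y \<noteq> x\<rbrakk> \<Longrightarrow> \<exists>W. weakly_visible X W \<and> y \<in> W \<and> x \<notin> W"
  shows "closedin (localizing_topology X) {x}"
proof -
  have "\<exists>T. openin (localizing_topology X) T \<and> y \<in> T \<and> T \<subseteq> topspace X - {x}"
    if y: "y \<in> topspace X - {x}" for y
  proof -
    obtain W where W: "weakly_visible X W" "y \<in> W" "x \<notin> W" using assms(2)[of y] y by blast
    then have "openin (localizing_topology X) W" by (intro openin_localizing_weakly_visible)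
    then show ?thesis using W openin_subset[of "localizing_topology X" W] by auto
  qed
  then have "openin (localizing_topology X) (topspace X - {x})"
    by (subst openin_subopen) blast
  then show ?thesis using assms(1) by (simp add: closedin_def)
qed


section \<open>The Balmer spectrum\<close>

context rigidly_compactly_generated
begin

abbreviation cpt :: "'o set" where "cpt \<equiv> compacts \<kappa> C"

text \<open>One of the two compact factors is regarded as rigid.\<close>

lemma cpt_ten: "\<lbrakk>a \<in> cpt; b \<in> cpt\<rbrakk> \<Longrightarrow> a \<odot> b \<in> cpt"
  using compact_ten_rigid[of \<kappa> a b] compact_iff_rigid[of b] by (simp add: compacts_def)

section \<open>Thick tensor ideals and prime avoidance\<close>

lemma thick_tensor_idealD:
  assumes "thick_tensor_ideal \<kappa> C P"
  shows "P \<subseteq> cpt" "thick_subcategory C P" "triangulated_subcategory C P"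
    "\<And>a b. \<lbrakk>a \<in> cpt; b \<in> P\<rbrakk> \<Longrightarrow> a \<odot> b \<in> P"
  using assms unfolding thick_tensor_ideal_def thick_subcategory_def by blast+

lemma ideal_ten_commute:
  "thick_tensor_ideal \<kappa> C P \<Longrightarrow> a \<odot> b \<in> P \<Longrightarrow> b \<odot> a \<in> P"
  using triangulated_isomorphic[OF thick_tensor_idealD(3)] isomorphic_brd by blast

text \<open>The ideal quotient (P : b) of commutative algebra, used to enlarge an ideal that is not
  prime.\<close>

lemma thick_tensor_ideal_quotient:
  assumes P: "thick_tensor_ideal \<kappa> C P"
  shows "thick_tensor_ideal \<kappa> C (cpt \<inter> {x. x \<odot> b \<in> P})"
proof -
  have "thick_subcategory C (\<Inter>{cpt, {x. x \<odot> b \<in> P}})"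
    by (rule thick_Inter) (use thick_compacts thick_ten[OF thick_tensor_idealD(2)[OF P]] in blast)
  moreover have "(a \<odot> x) \<odot> b \<in> P" if "a \<in> cpt" "x \<odot> b \<in> P" for a x
    using triangulated_isomorphic[OF thick_tensor_idealD(3)[OF P] _ isomorphic_sym[OF isomorphic_asc]]
      thick_tensor_idealD(4)[OF P that] by blast
  ultimately show ?thesis using cpt_ten by (simp add: thick_tensor_ideal_def)
qed

text \<open>Nonemptiness keeps the intersection inside the compact objects.\<close>

lemma thick_tensor_ideal_Inter:
  assumes "\<P> \<noteq> {}" "\<And>P. P \<in> \<P> \<Longrightarrow> thick_tensor_ideal \<kappa> C P"
  shows "thick_tensor_ideal \<kappa> C (\<Inter>\<P>)"
  using assms thick_Inter[of \<P>] unfolding thick_tensor_ideal_def by blast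

lemma thick_tensor_ideal_cpt: "thick_tensor_ideal \<kappa> C cpt"
  using thick_compacts cpt_ten unfolding thick_tensor_ideal_def by blast

text \<open>The multiplicative set generated by \<open>B\<close>, with no unit adjoined. Each member
  is built from finitely many elements of \<open>B\<close>, which is the source of finite
  subcovers.\<close>

inductive_set ten_closure :: "'o set \<Rightarrow> 'o set" for B where
  base: "b \<in> B \<Longrightarrow> b \<in> ten_closure B"
| ten: "\<lbrakk>s \<in> ten_closure B; t \<in> ten_closure B\<rbrakk> \<Longrightarrow> s \<odot> t \<in> ten_closure B"

lemma ten_closure_cpt:
  assumes "s \<in> ten_closure B" "B \<subseteq> cpt"
  shows "s \<in> cpt"
  using assms by induction (auto intro: cpt_ten)

lemma prime_avoiding:
  assumes J: "thick_tensor_ideal \<kappa> C J" "J \<inter> ten_closure B = {}" and B: "B \<noteq> {}" "B \<subseteq> cpt"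
  obtains P where "prime_ideal \<kappa> C P" "J \<subseteq> P" "P \<inter> ten_closure B = {}"
proof -
  let ?S = "ten_closure B"
  let ?\<A> = "{Q. thick_tensor_ideal \<kappa> C Q \<and> J \<subseteq> Q \<and> Q \<inter> ?S = {}}"
  have "?\<A> \<noteq> {}" using J by blast
  moreover have "\<Union>\<C> \<in> ?\<A>" if ne: "\<C> \<noteq> {}" and ch: "subset.chain ?\<A> \<C>" for \<C>
  proof -
    have \<C>: "\<And>Q. Q \<in> \<C> \<Longrightarrow> thick_tensor_ideal \<kappa> C Q \<and> J \<subseteq> Q \<and> Q \<inter> ?S = {}"
      "\<And>Q R. \<lbrakk>Q \<in> \<C>; R \<in> \<C>\<rbrakk> \<Longrightarrow> Q \<subseteq> R \<or> R \<subseteq> Q"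
      using ch unfolding subset_chain_def by blast+
    have "thick_subcategory C (\<Union>\<C>)"
      by (rule thick_Union_chain) (use ne \<C> thick_tensor_idealD(2) in blast)+
    then have "thick_tensor_ideal \<kappa> C (\<Union>\<C>)"
      using \<C>(1) unfolding thick_tensor_ideal_def by blast
    then show ?thesis using \<C>(1) ne by blast
  qed
  ultimately have "\<exists>P\<in>?\<A>. \<forall>Q\<in>?\<A>. P \<subseteq> Q \<longrightarrow> Q = P"
    by (rule subset_Zorn_nonempty)
  then obtain P where PA: "P \<in> ?\<A>" and max: "\<forall>Q\<in>?\<A>. P \<subseteq> Q \<longrightarrow> Q = P"
    by (rule bexE)
  have P: "thick_tensor_ideal \<kappa> C P" "J \<subseteq> P" "P \<inter> ?S = {}" using PA by simp_all
  note PD = thick_tensor_idealD[OF P(1)]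
  \<comment> \<open>The quotient (P : b) contains \<open>P\<close> and also \<open>a\<close>, so by
    maximality it meets the multiplicative set: \<open>a\<close> can be traded for an element
    \<open>s\<close> of that set.\<close>
  have quot: "\<exists>s\<in>?S. s \<odot> b \<in> P" if b: "b \<in> cpt" and a: "a \<in> cpt" "a \<odot> b \<in> P" "a \<notin> P" for a b
  proof -
    let ?Q = "cpt \<inter> {x. x \<odot> b \<in> P}"
    have PQ: "P \<subseteq> ?Q" using PD(1) PD(4)[OF b] ideal_ten_commute[OF P(1)] by blast
    moreover have "?Q \<noteq> P" using a by blast
    ultimately have "?Q \<notin> ?\<A>" using max by blast
    moreover have "J \<subseteq> ?Q" using P(2) PQ by (rule subset_trans)
    ultimately have "?Q \<inter> ?S \<noteq> {}"
      using thick_tensor_ideal_quotient[OF P(1), of b] by simp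
    then show ?thesis by blast
  qed
  have "a \<in> P \<or> b \<in> P" if ab: "a \<in> cpt" "b \<in> cpt" "a \<odot> b \<in> P" for a b
  proof (rule ccontr)
    assume "\<not> (a \<in> P \<or> b \<in> P)"
    \<comment> \<open>Trading \<open>a\<close> for \<open>s\<close> and then \<open>b\<close> for
      \<open>t\<close> puts the product \<open>t \<odot> s\<close> both in \<open>P\<close> and in
      the multiplicative set.\<close>
    then obtain s where s: "s \<in> ?S" "s \<odot> b \<in> P" using quot[of b a] ab by blast
    then obtain t where "t \<in> ?S" "t \<odot> s \<in> P"
      using quot[of s b] ab \<open>\<not> (a \<in> P \<or> b \<in> P)\<close> ideal_ten_commute[OF P(1)]
        ten_closure_cpt[OF s(1) B(2)] by blast
    then show False using s(1) P(3) ten_closure.ten by blast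
  qed
  \<comment> \<open>Any element of the nonempty \<open>B\<close> is compact and lies outside
    \<open>P\<close>.\<close>
  moreover have "P \<noteq> cpt" using B P(3) ten_closure.base by blast
  ultimately have "prime_ideal \<kappa> C P" using P(1) unfolding prime_ideal_def by blast
  then show thesis using P(2,3) that by blast
qed

section \<open>Basic open sets of the spectrum and their quasi-compactness\<close>

definition co_supp :: "'o \<Rightarrow> 'o set set" where
  "co_supp a = {P. prime_ideal \<kappa> C P \<and> a \<in> P}"

lemma co_supp_eq: "{P. prime_ideal \<kappa> C P} - supp \<kappa> C a = co_supp a"
  by (auto simp: co_supp_def supp_def)

lemma prime_idealD:
  assumes "prime_ideal \<kappa> C P"
  shows "thick_tensor_ideal \<kappa> C P" "P \<noteq> cpt"
    "\<And>a b. \<lbrakk>a \<in> cpt; b \<in> cpt; a \<odot> b \<in> P\<rbrakk> \<Longrightarrow> a \<in> P \<or> b \<in> P"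
  using assms unfolding prime_ideal_def by blast+

text \<open>A prime containing a product contains a factor, so unwinding the product leads to one of
  the finitely many generators used.\<close>

lemma co_supp_ten_closure:
  assumes "s \<in> ten_closure B" "B \<subseteq> cpt"
  shows "\<exists>F\<subseteq>B. finite F \<and> co_supp s \<subseteq> (\<Union>b\<in>F. co_supp b)"
  using assms
proof induction
  case (base b)
  then show ?case by (intro exI[of _ "{b}"]) auto
next
  case (ten s t)
  then obtain F G where "F \<subseteq> B" "finite F" "co_supp s \<subseteq> (\<Union>b\<in>F. co_supp b)"
    "G \<subseteq> B" "finite G" "co_supp t \<subseteq> (\<Union>b\<in>G. co_supp b)" by blast
  moreover have "co_supp (s \<odot> t) \<subseteq> co_supp s \<union> co_supp t"
    using prime_idealD(3) ten_closure_cpt[OF ten.hyps(1) ten.prems] ten_closure_cpt[OF ten.hyps(2) ten.prems]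
    unfolding co_supp_def by blast
  ultimately show ?case by (intro exI[of _ "F \<union> G"]) auto
qed

text \<open>If the ideal generated by \<open>a\<close> missed all products of elements of
  \<open>B\<close>, a prime containing it would contain \<open>a\<close> and no element of
  \<open>B\<close>, against the cover. So it contains such a product, as then does every prime
  containing \<open>a\<close>, and the finitely many factors of the product give the
  subcover.\<close>

lemma co_supp_finite_subcover:
  assumes a: "a \<in> cpt" and B: "B \<subseteq> cpt" and cover: "co_supp a \<subseteq> (\<Union>b\<in>B. co_supp b)"
  shows "\<exists>F\<subseteq>B. finite F \<and> co_supp a \<subseteq> (\<Union>b\<in>F. co_supp b)"
\<comment> \<open>With \<open>B\<close> empty there is no product to make the avoiding ideal proper,
  but then the cover already shows \<open>co_supp a\<close> to be empty.\<close>
proof (cases "B = {}")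
  case True
  then show ?thesis using cover by (intro exI[of _ "{}"]) auto
next
  case False
  let ?J = "\<Inter>{Q. thick_tensor_ideal \<kappa> C Q \<and> a \<in> Q}"
  have J: "thick_tensor_ideal \<kappa> C ?J"
    by (rule thick_tensor_ideal_Inter) (use a thick_tensor_ideal_cpt in blast)+
  have "?J \<inter> ten_closure B \<noteq> {}"
  proof
    assume "?J \<inter> ten_closure B = {}"
    then obtain P where P: "prime_ideal \<kappa> C P" "?J \<subseteq> P" "P \<inter> ten_closure B = {}"
      using prime_avoiding[OF J _ False B] by blast
    then have "P \<in> co_supp a" unfolding co_supp_def by blast
    then obtain b where "b \<in> B" "b \<in> P" using cover unfolding co_supp_def by blast
    then show False using P(3) ten_closure.base by blast
  qed
  then obtain s where s: "s \<in> ten_closure B" "s \<in> ?J" by blast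
  then have "co_supp a \<subseteq> co_supp s" using prime_idealD(1) unfolding co_supp_def by blast
  then show ?thesis using co_supp_ten_closure[OF s(1) B] by blast
qed

text \<open>The basic sets are closed under intersection because a thick ideal contains a biproduct
  exactly when it contains both summands.\<close>

lemma openin_Spc: "openin (Spc \<kappa> C) = arbitrary union_of (\<lambda>S. \<exists>a\<in>cpt. S = co_supp a)"
  unfolding Spc_def co_supp_eq
proof (intro topology_inverse' istopology_base)
  fix S T assume "\<exists>a\<in>cpt. S = co_supp a" "\<exists>a\<in>cpt. T = co_supp a"
  then obtain a b where ab: "a \<in> cpt" "b \<in> cpt" "S = co_supp a" "T = co_supp b" by blast
  obtain s i j p q where s: "biproduct C a b s i j p q" using biproduct_exists by blast
  have "s \<in> cpt" using thick_biproduct_iff[OF thick_compacts s] ab by blast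
  moreover have "S \<inter> T = co_supp s"
    unfolding ab co_supp_def
    using thick_biproduct_iff[OF thick_tensor_idealD(2)[OF prime_idealD(1)] s] by blast
  ultimately show "\<exists>a\<in>cpt. S \<inter> T = co_supp a" by blast
qed

lemma openin_co_supp: "a \<in> cpt \<Longrightarrow> openin (Spc \<kappa> C) (co_supp a)"
  unfolding openin_Spc by (intro arbitrary_union_of_inc) blast

text \<open>Every prime contains the zero objects, so the basic open set of a zero object is
  everything.\<close>

lemma topspace_Spc: "topspace (Spc \<kappa> C) = {P. prime_ideal \<kappa> C P}"
proof
  obtain z where z: "zero_obj C z" using zero_exists by blast
  have "co_supp z = {P. prime_ideal \<kappa> C P}"
    using triangulated_zero[OF thick_tensor_idealD(3)[OF prime_idealD(1)] z]
    unfolding co_supp_def by blast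
  moreover have "z \<in> cpt" using zero_obj_compact[OF z] by (simp add: compacts_def)
  ultimately show "{P. prime_ideal \<kappa> C P} \<subseteq> topspace (Spc \<kappa> C)"
    using openin_subset[OF openin_co_supp] by metis
  have "openin (Spc \<kappa> C) (topspace (Spc \<kappa> C))" by simp
  then obtain \<U> where "\<And>U. U \<in> \<U> \<Longrightarrow> \<exists>a\<in>cpt. U = co_supp a" "\<Union>\<U> = topspace (Spc \<kappa> C)"
    unfolding openin_Spc union_of_def by auto
  then show "topspace (Spc \<kappa> C) \<subseteq> {P. prime_ideal \<kappa> C P}"
    unfolding co_supp_def by blast
qed

lemma compactin_co_supp:
  assumes a: "a \<in> cpt"
  shows "compactin (Spc \<kappa> C) (co_supp a)"
  unfolding compactin_def
proof (intro conjI allI impI)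
  show "co_supp a \<subseteq> topspace (Spc \<kappa> C)" by (rule openin_subset[OF openin_co_supp[OF a]])
  fix \<U> assume \<U>: "Ball \<U> (openin (Spc \<kappa> C)) \<and> co_supp a \<subseteq> \<Union>\<U>"
  \<comment> \<open>The basic open sets lying in a single member of the cover; a finite subcover by
    them is enlarged to one by members of \<open>\<U>\<close>.\<close>
  define B where "B = {b \<in> cpt. \<exists>U\<in>\<U>. co_supp b \<subseteq> U}"
  have "co_supp a \<subseteq> (\<Union>b\<in>B. co_supp b)"
  proof
    fix P assume "P \<in> co_supp a"
    then obtain U where U: "U \<in> \<U>" "P \<in> U" "openin (Spc \<kappa> C) U" using \<U> by blast
    then obtain \<V> where \<V>: "\<And>V. V \<in> \<V> \<Longrightarrow> \<exists>b\<in>cpt. V = co_supp b" "\<Union>\<V> = U"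
      unfolding openin_Spc union_of_def by auto
    then obtain b where "b \<in> cpt" "P \<in> co_supp b" "co_supp b \<subseteq> U" using U(2) by blast
    then show "P \<in> (\<Union>b\<in>B. co_supp b)" using U(1) unfolding B_def by blast
  qed
  then obtain F where F: "F \<subseteq> B" "finite F" "co_supp a \<subseteq> (\<Union>b\<in>F. co_supp b)"
    using co_supp_finite_subcover[OF a, of B] unfolding B_def by blast
  have "\<forall>b\<in>F. \<exists>U. U \<in> \<U> \<and> co_supp b \<subseteq> U" using F(1) unfolding B_def by blast
  from bchoice[OF this] obtain u where u: "\<forall>b\<in>F. u b \<in> \<U> \<and> co_supp b \<subseteq> u b" by blast
  then show "\<exists>\<F>. finite \<F> \<and> \<F> \<subseteq> \<U> \<and> co_supp a \<subseteq> \<Union>\<F>"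
  proof (intro exI conjI)
    show "co_supp a \<subseteq> \<Union>(u ` F)" using F(3) u by blast
  qed (use F(2) u in auto)
qed

lemma thomason_supp:
  assumes a: "a \<in> cpt"
  shows "thomason (Spc \<kappa> C) (supp \<kappa> C a)"
proof -
  have "topspace (Spc \<kappa> C) - supp \<kappa> C a = co_supp a"
    by (simp add: topspace_Spc co_supp_eq)
  moreover have "supp \<kappa> C a \<subseteq> topspace (Spc \<kappa> C)" by (auto simp: supp_def topspace_Spc)
  ultimately show ?thesis
    using openin_co_supp[OF a] compactin_co_supp[OF a]
    unfolding thomason_def by (intro exI[of _ "{supp \<kappa> C a}"]) (simp add: closedin_def)
qed

text \<open>Distinct primes differ in some compact \<open>a\<close>. The Thomason set
  \<open>supp \<kappa> C a\<close> and its complement are both weakly visible, and one of them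
  contains \<open>Q\<close> but not \<open>P\<close>.\<close>

lemma closedin_localizing_prime:
  assumes P: "P \<in> topspace (Spc \<kappa> C)"
  shows "closedin (localizing_topology (Spc \<kappa> C)) {P}"
proof (rule closedin_localizing_singleton[OF P])
  fix Q assume Q: "Q \<in> topspace (Spc \<kappa> C)" "Q \<noteq> P"
  have "P \<subseteq> cpt" "Q \<subseteq> cpt"
    using P Q thick_tensor_idealD(1)[OF prime_idealD(1)] unfolding topspace_Spc by blast+
  then obtain a where a: "a \<in> cpt" "a \<in> P \<and> a \<notin> Q \<or> a \<in> Q \<and> a \<notin> P" using Q(2) by blast
  note t = thomason_supp[OF a(1)]
  show "\<exists>W. weakly_visible (Spc \<kappa> C) W \<and> Q \<in> W \<and> P \<notin> W"
    using a(2)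
  proof
    assume "a \<in> P \<and> a \<notin> Q"
    then show ?thesis using weakly_visible_thomason[OF t] Q(1)
      by (intro exI[of _ "supp \<kappa> C a"]) (auto simp: supp_def topspace_Spc)
  next
    assume "a \<in> Q \<and> a \<notin> P"
    then show ?thesis using weakly_visible_co_thomason[OF t] P Q(1)
      by (intro exI[of _ "topspace (Spc \<kappa> C) - supp \<kappa> C a"]) (auto simp: supp_def topspace_Spc)
  qed
qed


section \<open>Stratification\<close>

lemma zero_obj_ten_unit: "zero_obj C (t \<odot> \<I>) \<longleftrightarrow> zero_obj C t"
proof -
  have "isomorphic C (t \<odot> \<I>) t" unfolding isomorphic_def using run_Iso by blast
  then show ?thesis using zero_obj_isomorphic isomorphic_sym by blast
qed

lemma Supp_iff: "P \<in> Supp \<kappa> C t \<longleftrightarrow> P \<in> topspace (Spc \<kappa> C) \<and>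
    (\<forall>W. weakly_visible (Spc \<kappa> C) W \<and> P \<in> W \<longrightarrow> \<not> zero_obj C (t \<odot> g_obj \<kappa> C W))"
  unfolding Supp_def using zero_obj_ten_commute by blast

text \<open>A test object annihilating one factor annihilates the product.\<close>

lemma Supp_ten: "Supp \<kappa> C (s \<odot> t) \<subseteq> Supp \<kappa> C s \<inter> Supp \<kappa> C t"
proof -
  have "zero_obj C ((s \<odot> t) \<odot> c)" if "zero_obj C (s \<odot> c)" for s t c
    using zero_obj_isomorphic[OF isomorphic_ten_swap zero_obj_ten[OF that]] .
  moreover have "zero_obj C ((s \<odot> t) \<odot> c) \<longleftrightarrow> zero_obj C ((t \<odot> s) \<odot> c)" for s t c
    using zero_obj_isomorphic isomorphic_ten[OF isomorphic_brd] by blast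
  ultimately show ?thesis unfolding Supp_iff subset_iff Int_iff by blast
qed

text \<open>It suffices that at each prime one admissible test object lies in \<open>K\<close>: it
  excludes that prime from the support of everything annihilated by \<open>K\<close>.\<close>

lemma SuppC_annihilator_empty:
  assumes "\<And>P. P \<in> topspace (Spc \<kappa> C)
    \<Longrightarrow> \<exists>W. weakly_visible (Spc \<kappa> C) W \<and> P \<in> W \<and> g_obj \<kappa> C W \<in> K"
  shows "SuppC \<kappa> C (annihilator K) = {}"
proof -
  have "P \<notin> Supp \<kappa> C t" if t: "t \<in> annihilator K" for P t
  proof
    assume P: "P \<in> Supp \<kappa> C t"
    then have "P \<in> topspace (Spc \<kappa> C)" unfolding Supp_iff by blast
    then obtain W where W: "weakly_visible (Spc \<kappa> C) W" "P \<in> W" "g_obj \<kappa> C W \<in> K"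
      using assms by blast
    then have "zero_obj C (t \<odot> g_obj \<kappa> C W)" using t unfolding annihilator_def by blast
    then show False using P W(1,2) unfolding Supp_iff by blast
  qed
  then show ?thesis unfolding SuppC_def by blast
qed

lemma Supp_zero:
  assumes "zero_obj C t"
  shows "Supp \<kappa> C t = {}"
proof -
  have "P \<notin> Supp \<kappa> C t" for P
    unfolding Supp_iff
    using zero_obj_ten[OF assms] weakly_visible_thomason[OF thomason_topspace] by blast
  then show ?thesis by blast
qed

lemma stratified_detection:
  assumes "stratified \<kappa> C" and empty: "Supp \<kappa> C x = {}"
  shows "zero_obj C x"
proof -
  have inj: "inj_on (SuppC \<kappa> C) {L. localizing_ideal \<kappa> C L}"
    using assms(1) unfolding stratified_def bij_betw_def by blast
  let ?K = "{c. zero_obj C (x \<odot> c)}"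
  have "SuppC \<kappa> C (annihilator ?K) = {}"
    by (rule SuppC_annihilator_empty) (use empty Supp_iff in blast)
  \<comment> \<open>The ideal of zero objects is the comparison: it too has empty support, so
    injectivity equates both ideals, and \<open>x\<close> lies in the first.\<close>
  moreover have "SuppC \<kappa> C (annihilator UNIV) = {}"
    by (rule SuppC_annihilator_empty)
      (use weakly_visible_thomason[OF thomason_topspace] in blast)
  ultimately have "annihilator ?K = annihilator UNIV"
    by (intro inj_onD[OF inj]) (simp_all add: localizing_ideal_annihilator)
  moreover have "x \<in> annihilator ?K" by (simp add: annihilator_def)
  ultimately have "zero_obj C (x \<odot> \<I>)" unfolding annihilator_def by blast
  then show ?thesis by (simp add: zero_obj_ten_unit)
qed

text \<open>Surjectivity gives a localizing ideal supported at \<open>P\<close>; a member with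
  \<open>P\<close> in its support can have no other point there.\<close>

lemma stratified_point_object:
  assumes "stratified \<kappa> C" "P \<in> topspace (Spc \<kappa> C)"
  obtains t where "Supp \<kappa> C t = {P}"
proof -
  have "{P} \<in> SuppC \<kappa> C ` {L. localizing_ideal \<kappa> C L}"
    using assms(1) closedin_localizing_prime[OF assms(2)] unfolding stratified_def bij_betw_def
    by blast
  then obtain L where L: "(\<Union>t\<in>L. Supp \<kappa> C t) = {P}" unfolding SuppC_def by blast
  then obtain t where t: "t \<in> L" "P \<in> Supp \<kappa> C t" by (metis UN_E singletonI)
  have "Supp \<kappa> C t \<subseteq> {P}" unfolding L[symmetric] using t(1) by blast
  then have "Supp \<kappa> C t = {P}" using t(2) by blast
  then show thesis by (rule that)
qed

lemma stratified_imp_weakly_noetherian: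
  assumes strat: "stratified \<kappa> C"
  shows "weakly_noetherian (Spc \<kappa> C)"
  unfolding weakly_noetherian_def
proof (intro ballI weakly_visible_singleton)
  fix P assume P: "P \<in> topspace (Spc \<kappa> C)"
  let ?X = "localizing_topology (Spc \<kappa> C)"
  obtain t where t: "Supp \<kappa> C t = {P}" using stratified_point_object[OF strat P] by blast
  let ?M = "annihilator {t}"
  have inj: "inj_on (SuppC \<kappa> C) {L. localizing_ideal \<kappa> C L}"
    and closed: "closedin ?X (SuppC \<kappa> C ?M)"
    using strat localizing_ideal_annihilator unfolding stratified_def bij_betw_def by blast+
  have "Q \<in> SuppC \<kappa> C ?M" if Q: "Q \<in> topspace (Spc \<kappa> C)" "Q \<noteq> P" for Q
  proof -
    obtain s where s: "Supp \<kappa> C s = {Q}" using stratified_point_object[OF strat Q(1)] by blast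
    have "Supp \<kappa> C (s \<odot> t) = {}" using Supp_ten[of s t] s t Q(2) by blast
    then have "s \<in> ?M" using stratified_detection[OF strat] by (simp add: annihilator_def)
    then show ?thesis using s unfolding SuppC_def by blast
  qed
  moreover have sub: "SuppC \<kappa> C L \<subseteq> topspace (Spc \<kappa> C)" for L
    unfolding SuppC_def Supp_def by blast
  moreover have "P \<notin> SuppC \<kappa> C ?M"
  proof
    assume "P \<in> SuppC \<kappa> C ?M"
    then have "topspace (Spc \<kappa> C) \<subseteq> SuppC \<kappa> C ?M" using calculation(1) by blast
    \<comment> \<open>The ideal \<open>annihilator {}\<close> of all objects. If \<open>P\<close>
      belonged to the support of \<open>?M\<close>, both ideals would have the whole spectrum as
      support and coincide, so the unit would annihilate \<open>t\<close>.\<close>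
    moreover have "SuppC \<kappa> C ?M \<subseteq> SuppC \<kappa> C (annihilator {})"
      unfolding SuppC_def annihilator_def by blast
    ultimately have "SuppC \<kappa> C ?M = SuppC \<kappa> C (annihilator {})" using sub by blast
    then have "?M = annihilator {}"
      by (rule inj_onD[OF inj]) (simp_all add: localizing_ideal_annihilator)
    then have "\<I> \<in> ?M" unfolding annihilator_def by blast
    then have "zero_obj C (t \<odot> \<I>)"
      using zero_obj_ten_commute unfolding annihilator_def by blast
    then have "Supp \<kappa> C t = {}" unfolding zero_obj_ten_unit by (rule Supp_zero)
    then show False using t by simp
  qed
  ultimately have "SuppC \<kappa> C ?M = topspace (Spc \<kappa> C) - {P}" by blast
  then have "openin ?X (topspace (Spc \<kappa> C) - (topspace (Spc \<kappa> C) - {P}))"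
    using closed by (simp add: closedin_def)
  moreover have "topspace (Spc \<kappa> C) - (topspace (Spc \<kappa> C) - {P}) = {P}" using P by blast
  ultimately show "openin ?X {P}" by simp
qed

end

theorem theorem1:
  fixes \<kappa> :: "'u rel" and T :: "('o, 'm) ttcat"
  assumes "rigidly_compactly_generated \<kappa> T"
    and "stratified \<kappa> T"
  shows "weakly_noetherian (Spc \<kappa> T)"
  using rigidly_compactly_generated.stratified_imp_weakly_noetherian[OF assms] .

end
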